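(* Let $\mathbb{D}$ be a small category, $\mathsf{K}$ an order enriched category and $J$ a subcategory containing all objects of $\mathsf{K}$, and assume: $J$ and $\mathsf{K}$ have coproducts of all families indexed by objects of $\mathbb{D}$ and the inclusion $J\hookrightarrow\mathsf{K}$ preserves them; $\mathsf{K}$ is left distributive $\mathsf{DCpo}^\vee$-enriched; cotupling preserves the order. Then the functor $\Sigma_!:[\mathbb{D},\mathsf{K}]^J\to[1,\mathsf{K}]^J$ is a left 2-adjoint to the change-of-base functor $[!,\mathsf{K}]^J:[1,\mathsf{K}]^J\to[\mathbb{D},\mathsf{K}]^J$.
   Context: Lax functors $\pi:\mathbb{D}\to\mathsf{K}$ satisfy $id_{\pi D}\leq\pi(id_D)$, $\pi(d_1)\circ\pi(d_2)\leq\pi(d_1\circ d_2)$; oplax transformations $f:\pi\to\pi'$ satisfy $f_{D'}\circ\pi(d)\leq\pi'(d)\circ f_D$. $[\mathbb{D},\mathsf{K}]^J$: lax functors and oplax transformations with components in $J$, ordered componentwise. $[1,\mathsf{K}]^J$: endomorphisms $\rho$ of $\mathsf{K}$ with $id\leq\rho$, $\rho\circ\rho\leq\rho$, and morphisms $J$-arrows $f$ with $f\circ\rho\leq\rho'\circ f$. $!:\mathbb{D}\to1$ is the unique functor to the one-object one-morphism category; $[!,\mathsf{K}]^J$ sends $\rho:Y\to Y$ to the lax functor $\mathbb{D}\to\mathsf{K}$ with every object mapped to $Y$ and every morphism to $\rho$, and a morphism $f$ to the transformation all of whose components are $f$. $\mathsf{DCpo}^\vee$-enriched: hom-sets have binary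 joins and directed suprema, composition is monotone and preserves directed suprema in each variable; left distributive: $h\circ(f\vee g)=h\circ f\vee h\circ g$. Cotupling preserves order: $f_i\leq g_i$ for all $i$ implies $[f_i]\leq[g_i]$ (index sets of size at most the number of objects of $\mathbb{D}$). Definition of $\Sigma_!$: for $\pi$, $X=\sum_D\pi(D)$; for $d:D_1\to D_2$, $\overline{\pi(d)}=[\delta_D]_D:X\to X$ with $\delta_{D_1}=\mathsf{in}_{\pi D_2}\circ\pi(d)$ and $\delta_D=\mathsf{in}_{\pi D}$ for $D\neq D_1$; $\Pi=\{\overline{\pi(d_1)}\vee\dots\vee\overline{\pi(d_k)}\mid k\geq1\}$; $\Sigma_!(\pi)=\bigvee_{l\in\mathbb{N}}(\bigvee\Pi)^l$; $\Sigma_!(f)=\sum_Df_D$. A 2-adjunction is a pair of hom-order preserving functors with poset isomorphisms of hom-sets natural in both variables. *)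

theory Defs
  imports "HOL-Algebra.Lattice" "HOL-Library.Equipollence"
begin

section \<open>Categories and order-enriched categories\<close>

record ('o, 'a) cat =
  Obj :: "'o set"
  Arr :: "'a set"
  Dom :: "'a \<Rightarrow> 'o"
  Cod :: "'a \<Rightarrow> 'o"
  Idt :: "'o \<Rightarrow> 'a"
  Comp :: "'a \<Rightarrow> 'a \<Rightarrow> 'a"  (infixr \<open>\<cdot>\<index>\<close> 70)

record ('o, 'a) ocat = "('o, 'a) cat" +
  Le :: "'a \<Rightarrow> 'a \<Rightarrow> bool"  (infix \<open>\<preceq>\<index>\<close> 50)

definition Hom :: "('o, 'a, 'm) cat_scheme \<Rightarrow> 'o \<Rightarrow> 'o \<Rightarrow> 'a set" where
  "Hom C X Y = {f \<in> Arr C. Dom C f = X \<and> Cod C f = Y}"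

locale category =
  fixes C :: "('o, 'a, 'm) cat_scheme" (structure)
  assumes Dom_closed: "f \<in> Arr C \<Longrightarrow> Dom C f \<in> Obj C"
    and Cod_closed: "f \<in> Arr C \<Longrightarrow> Cod C f \<in> Obj C"
    and Idt_in_Hom: "X \<in> Obj C \<Longrightarrow> Idt C X \<in> Hom C X X"
    and Comp_in_Hom: "f \<in> Hom C X Y \<Longrightarrow> g \<in> Hom C Y Z \<Longrightarrow> g \<cdot> f \<in> Hom C X Z"
    and Comp_assoc: "f \<in> Hom C W X \<Longrightarrow> g \<in> Hom C X Y \<Longrightarrow> h \<in> Hom C Y Z \<Longrightarrow>
          (h \<cdot> g) \<cdot> f = h \<cdot> (g \<cdot> f)"
    and Comp_Idt_right: "f \<in> Hom C X Y \<Longrightarrow> f \<cdot> Idt C X = f"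
    and Comp_Idt_left: "f \<in> Hom C X Y \<Longrightarrow> Idt C Y \<cdot> f = f"

text \<open>The relation \<open>Le\<close> is meaningful only between parallel arrows, so order-theoretic
  notions are always those of the hom-posets below.\<close>

definition Hom_poset :: "('o, 'a, 'm) ocat_scheme \<Rightarrow> 'o \<Rightarrow> 'o \<Rightarrow> 'a gorder" where
  "Hom_poset K X Y = \<lparr>carrier = Hom K X Y, eq = (=), le = Le K\<rparr>"

locale order_category = category K for K :: "('o, 'a, 'm) ocat_scheme" (structure) +
  assumes Hom_partial_order: "X \<in> Obj K \<Longrightarrow> Y \<in> Obj K \<Longrightarrow> partial_order (Hom_poset K X Y)"
    and Comp_mono: "f \<in> Hom K X Y \<Longrightarrow> f' \<in> Hom K X Y \<Longrightarrow> g \<in> Hom K Y Z \<Longrightarrow> g' \<in> Hom K Y Z \<Longrightarrow>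
          f \<preceq> f' \<Longrightarrow> g \<preceq> g' \<Longrightarrow> g \<cdot> f \<preceq> g' \<cdot> f'"

definition directed_in :: "('a, 'm) gorder_scheme \<Rightarrow> 'a set \<Rightarrow> bool" where
  "directed_in L A \<longleftrightarrow> A \<subseteq> carrier L \<and> A \<noteq> {} \<and>
     (\<forall>a\<in>A. \<forall>b\<in>A. \<exists>c\<in>A. a \<sqsubseteq>\<^bsub>L\<^esub> c \<and> b \<sqsubseteq>\<^bsub>L\<^esub> c)"

locale dcpo_join_category = order_category K for K :: "('o, 'a, 'm) ocat_scheme" (structure) +
  assumes Hom_joins: "X \<in> Obj K \<Longrightarrow> Y \<in> Obj K \<Longrightarrow> upper_semilattice (Hom_poset K X Y)"
    and Hom_directed_sup: "X \<in> Obj K \<Longrightarrow> Y \<in> Obj K \<Longrightarrow> directed_in (Hom_poset K X Y) A \<Longrightarrow>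
          \<exists>u. least (Hom_poset K X Y) u (Upper (Hom_poset K X Y) A)"
    and Comp_directed_sup_left: "f \<in> Hom K X Y \<Longrightarrow> Z \<in> Obj K \<Longrightarrow>
          directed_in (Hom_poset K Y Z) A \<Longrightarrow>
          least (Hom_poset K Y Z) u (Upper (Hom_poset K Y Z) A) \<Longrightarrow>
          least (Hom_poset K X Z) (u \<cdot> f) (Upper (Hom_poset K X Z) ((\<lambda>g. g \<cdot> f) ` A))"
    and Comp_directed_sup_right: "g \<in> Hom K Y Z \<Longrightarrow> X \<in> Obj K \<Longrightarrow>
          directed_in (Hom_poset K X Y) A \<Longrightarrow>
          least (Hom_poset K X Y) u (Upper (Hom_poset K X Y) A) \<Longrightarrow>
          least (Hom_poset K X Z) (g \<cdot> u) (Upper (Hom_poset K X Z) ((\<lambda>f. g \<cdot> f) ` A))"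

locale left_distributive_dcpo_join_category =
  dcpo_join_category K for K :: "('o, 'a, 'm) ocat_scheme" (structure) +
  assumes left_distrib: "f \<in> Hom K X Y \<Longrightarrow> g \<in> Hom K X Y \<Longrightarrow> h \<in> Hom K Y Z \<Longrightarrow>
      h \<cdot> (f \<squnion>\<^bsub>Hom_poset K X Y\<^esub> g) = (h \<cdot> f) \<squnion>\<^bsub>Hom_poset K X Z\<^esub> (h \<cdot> g)"

text \<open>A subcategory containing all objects is given by its set of arrows.\<close>

locale wide_subcategory =
  fixes K :: "('o, 'a, 'm) cat_scheme" (structure) and J :: "'a set"
  assumes sub_Arr: "J \<subseteq> Arr K"
    and sub_Idt: "X \<in> Obj K \<Longrightarrow> Idt K X \<in> J"
    and sub_Comp: "f \<in> J \<Longrightarrow> g \<in> J \<Longrightarrow> Cod K f = Dom K g \<Longrightarrow> g \<cdot> f \<in> J"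

definition subcat :: "('o, 'a, 'm) cat_scheme \<Rightarrow> 'a set \<Rightarrow> ('o, 'a, 'm) cat_scheme" where
  "subcat K J = K\<lparr>Arr := J\<rparr>"


section \<open>Coproducts\<close>

definition is_coproduct ::
  "('o, 'a, 'm) cat_scheme \<Rightarrow> 'i set \<Rightarrow> ('i \<Rightarrow> 'o) \<Rightarrow> 'o \<Rightarrow> ('i \<Rightarrow> 'a) \<Rightarrow> bool" where
  "is_coproduct C I F S \<iota> \<longleftrightarrow>
     S \<in> Obj C \<and> (\<forall>i\<in>I. F i \<in> Obj C \<and> \<iota> i \<in> Hom C (F i) S) \<and>
     (\<forall>Z\<in>Obj C. \<forall>f. (\<forall>i\<in>I. f i \<in> Hom C (F i) Z) \<longrightarrow>
        (\<exists>!h. h \<in> Hom C S Z \<and> (\<forall>i\<in>I. h \<cdot>\<^bsub>C\<^esub> \<iota> i = f i)))"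

definition has_coproducts :: "('o, 'a, 'm) cat_scheme \<Rightarrow> 'i set \<Rightarrow> bool" where
  "has_coproducts C I \<longleftrightarrow> (\<forall>F \<in> I \<rightarrow> Obj C. \<exists>S \<iota>. is_coproduct C I F S \<iota>)"

definition inclusion_preserves_coproducts ::
  "('o, 'a, 'm) cat_scheme \<Rightarrow> 'a set \<Rightarrow> 'i set \<Rightarrow> bool" where
  "inclusion_preserves_coproducts K J I \<longleftrightarrow>
     (\<forall>F S \<iota>. is_coproduct (subcat K J) I F S \<iota> \<longrightarrow> is_coproduct K I F S \<iota>)"

text \<open>The codomain \<open>Z\<close> is an argument because a cotuple of an empty family does not determine it.\<close>

definition cotuple ::
  "('o, 'a, 'm) cat_scheme \<Rightarrow> 'i set \<Rightarrow> 'o \<Rightarrow> ('i \<Rightarrow> 'a) \<Rightarrow> 'o \<Rightarrow> ('i \<Rightarrow> 'a) \<Rightarrow> 'a" where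
  "cotuple C I S \<iota> Z f = (THE h. h \<in> Hom C S Z \<and> (\<forall>i\<in>I. h \<cdot>\<^bsub>C\<^esub> \<iota> i = f i))"

text \<open>An arbitrary set of cardinality at most that of \<open>U\<close> can be reindexed by a set of
  elements of the type of \<open>U\<close>, so quantifying over \<open>I :: 'i set\<close> covers all such index sets.\<close>

definition cotupling_preserves_order :: "('o, 'a, 'm) ocat_scheme \<Rightarrow> 'i set \<Rightarrow> bool" where
  "cotupling_preserves_order K U \<longleftrightarrow>
     (\<forall>(I :: 'i set) F S \<iota> Z f g.
        I \<lesssim> U \<longrightarrow> is_coproduct K I F S \<iota> \<longrightarrow> Z \<in> Obj K \<longrightarrow>
        (\<forall>i\<in>I. f i \<in> Hom K (F i) Z \<and> g i \<in> Hom K (F i) Z \<and> f i \<preceq>\<^bsub>K\<^esub> g i) \<longrightarrow>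
        cotuple K I S \<iota> Z f \<preceq>\<^bsub>K\<^esub> cotuple K I S \<iota> Z g)"

text \<open>A choice of coproducts for all families indexed by \<open>I\<close>: the object \<open>S F\<close> with the
  injections \<open>\<iota> F\<close>.\<close>

definition coproduct_choice ::
  "('o, 'a, 'm) cat_scheme \<Rightarrow> 'i set \<Rightarrow> (('i \<Rightarrow> 'o) \<Rightarrow> 'o) \<Rightarrow> (('i \<Rightarrow> 'o) \<Rightarrow> 'i \<Rightarrow> 'a) \<Rightarrow> bool" where
  "coproduct_choice C I S \<iota> \<longleftrightarrow> (\<forall>F \<in> I \<rightarrow>\<^sub>E Obj C. is_coproduct C I F (S F) (\<iota> F))"


section \<open>2-functors and 2-adjunctions of order-enriched categories\<close>

record ('o, 'a, 'p, 'b) mapping =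
  omap :: "'o \<Rightarrow> 'p"
  amap :: "'a \<Rightarrow> 'b"

locale order_functor = C: order_category C + E: order_category E
  for C :: "('o, 'a, 'm) ocat_scheme" and E :: "('p, 'b, 'n) ocat_scheme" +
  fixes F :: "('o, 'a, 'p, 'b) mapping"
  assumes omap_closed: "X \<in> Obj C \<Longrightarrow> omap F X \<in> Obj E"
    and amap_closed: "f \<in> Hom C X Y \<Longrightarrow> amap F f \<in> Hom E (omap F X) (omap F Y)"
    and amap_Idt: "X \<in> Obj C \<Longrightarrow> amap F (Idt C X) = Idt E (omap F X)"
    and amap_Comp: "f \<in> Hom C X Y \<Longrightarrow> g \<in> Hom C Y Z \<Longrightarrow>
          amap F (g \<cdot>\<^bsub>C\<^esub> f) = amap F g \<cdot>\<^bsub>E\<^esub> amap F f"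
    and amap_mono: "f \<in> Hom C X Y \<Longrightarrow> g \<in> Hom C X Y \<Longrightarrow> f \<preceq>\<^bsub>C\<^esub> g \<Longrightarrow> amap F f \<preceq>\<^bsub>E\<^esub> amap F g"

definition poset_iso :: "('a, 'm) gorder_scheme \<Rightarrow> ('b, 'n) gorder_scheme \<Rightarrow> ('a \<Rightarrow> 'b) \<Rightarrow> bool" where
  "poset_iso L M \<phi> \<longleftrightarrow> bij_betw \<phi> (carrier L) (carrier M) \<and>
     (\<forall>x\<in>carrier L. \<forall>y\<in>carrier L. x \<sqsubseteq>\<^bsub>L\<^esub> y \<longleftrightarrow> \<phi> x \<sqsubseteq>\<^bsub>M\<^esub> \<phi> y)"

definition left_2adjoint ::
  "('o, 'a, 'm) ocat_scheme \<Rightarrow> ('p, 'b, 'n) ocat_scheme \<Rightarrow>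
   ('o, 'a, 'p, 'b) mapping \<Rightarrow> ('p, 'b, 'o, 'a) mapping \<Rightarrow> bool" where
  "left_2adjoint C E F G \<longleftrightarrow>
     order_functor C E F \<and> order_functor E C G \<and>
     (\<exists>\<Phi>.
       (\<forall>X\<in>Obj C. \<forall>Y\<in>Obj E.
          poset_iso (Hom_poset E (omap F X) Y) (Hom_poset C X (omap G Y)) (\<Phi> X Y)) \<and>
       (\<forall>X\<in>Obj C. \<forall>X'\<in>Obj C. \<forall>Y\<in>Obj E. \<forall>h\<in>Hom C X' X. \<forall>f\<in>Hom E (omap F X) Y.
          \<Phi> X' Y (f \<cdot>\<^bsub>E\<^esub> amap F h) = \<Phi> X Y f \<cdot>\<^bsub>C\<^esub> h) \<and>
       (\<forall>X\<in>Obj C. \<forall>Y\<in>Obj E. \<forall>Y'\<in>Obj E. \<forall>k\<in>Hom E Y Y'. \<forall>f\<in>Hom E (omap F X) Y.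
          \<Phi> X Y' (k \<cdot>\<^bsub>E\<^esub> f) = amap G k \<cdot>\<^bsub>C\<^esub> \<Phi> X Y f))"


section \<open>Lax functors, oplax transformations and change of base\<close>

text \<open>Lax functors and transformations are extensional outside \<open>D\<close>, so that HOL equality is
  the intended equality.\<close>

definition lax_functor ::
  "('d, 'e, 'k) cat_scheme \<Rightarrow> ('o, 'a, 'm) ocat_scheme \<Rightarrow> ('d, 'e, 'o, 'a) mapping \<Rightarrow> bool" where
  "lax_functor D K \<pi> \<longleftrightarrow>
     omap \<pi> \<in> Obj D \<rightarrow>\<^sub>E Obj K \<and> amap \<pi> \<in> extensional (Arr D) \<and>
     (\<forall>d\<in>Arr D. amap \<pi> d \<in> Hom K (omap \<pi> (Dom D d)) (omap \<pi> (Cod D d))) \<and>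
     (\<forall>X\<in>Obj D. Idt K (omap \<pi> X) \<preceq>\<^bsub>K\<^esub> amap \<pi> (Idt D X)) \<and>
     (\<forall>d1\<in>Arr D. \<forall>d2\<in>Arr D. Cod D d2 = Dom D d1 \<longrightarrow>
        amap \<pi> d1 \<cdot>\<^bsub>K\<^esub> amap \<pi> d2 \<preceq>\<^bsub>K\<^esub> amap \<pi> (d1 \<cdot>\<^bsub>D\<^esub> d2))"

definition oplax_transformation ::
  "('d, 'e, 'k) cat_scheme \<Rightarrow> ('o, 'a, 'm) ocat_scheme \<Rightarrow> 'a set \<Rightarrow>
   ('d, 'e, 'o, 'a) mapping \<Rightarrow> ('d, 'e, 'o, 'a) mapping \<Rightarrow> ('d \<Rightarrow> 'a) \<Rightarrow> bool" where
  "oplax_transformation D K J \<pi> \<pi>' f \<longleftrightarrow>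
     f \<in> extensional (Obj D) \<and>
     (\<forall>X\<in>Obj D. f X \<in> J \<and> f X \<in> Hom K (omap \<pi> X) (omap \<pi>' X)) \<and>
     (\<forall>d\<in>Arr D. f (Cod D d) \<cdot>\<^bsub>K\<^esub> amap \<pi> d \<preceq>\<^bsub>K\<^esub> amap \<pi>' d \<cdot>\<^bsub>K\<^esub> f (Dom D d))"

text \<open>\<open>lax_cat D K J\<close> is \<open>[D, K]\<^sup>J\<close>; an arrow is a transformation together with its source and target.\<close>

definition lax_cat ::
  "('d, 'e, 'k) cat_scheme \<Rightarrow> ('o, 'a, 'm) ocat_scheme \<Rightarrow> 'a set \<Rightarrow>
   (('d, 'e, 'o, 'a) mapping,
    ('d, 'e, 'o, 'a) mapping \<times> ('d \<Rightarrow> 'a) \<times> ('d, 'e, 'o, 'a) mapping) ocat" where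
  "lax_cat D K J =
    \<lparr>Obj = {\<pi>. lax_functor D K \<pi>},
     Arr = {(\<pi>, f, \<pi>'). lax_functor D K \<pi> \<and> lax_functor D K \<pi>' \<and> oplax_transformation D K J \<pi> \<pi>' f},
     Dom = (\<lambda>(\<pi>, f, \<pi>'). \<pi>),
     Cod = (\<lambda>(\<pi>, f, \<pi>'). \<pi>'),
     Idt = (\<lambda>\<pi>. (\<pi>, \<lambda>X\<in>Obj D. Idt K (omap \<pi> X), \<pi>)),
     Comp = (\<lambda>(_, g, \<pi>'') (\<pi>, f, _). (\<pi>, \<lambda>X\<in>Obj D. g X \<cdot>\<^bsub>K\<^esub> f X, \<pi>'')),
     Le = (\<lambda>(_, f, _) (_, g, _). \<forall>X\<in>Obj D. f X \<preceq>\<^bsub>K\<^esub> g X)\<rparr>"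

text \<open>\<open>lax_endo_cat K J\<close> is \<open>[1, K]\<^sup>J\<close>, its objects being represented by the image of the only
  arrow of \<open>1\<close>.\<close>

definition lax_endo :: "('o, 'a, 'm) ocat_scheme \<Rightarrow> 'a \<Rightarrow> bool" where
  "lax_endo K \<rho> \<longleftrightarrow> \<rho> \<in> Arr K \<and> Dom K \<rho> = Cod K \<rho> \<and>
     Idt K (Dom K \<rho>) \<preceq>\<^bsub>K\<^esub> \<rho> \<and> \<rho> \<cdot>\<^bsub>K\<^esub> \<rho> \<preceq>\<^bsub>K\<^esub> \<rho>"

definition lax_endo_cat ::
  "('o, 'a, 'm) ocat_scheme \<Rightarrow> 'a set \<Rightarrow> ('a, 'a \<times> 'a \<times> 'a) ocat" where
  "lax_endo_cat K J =
    \<lparr>Obj = {\<rho>. lax_endo K \<rho>},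
     Arr = {(\<rho>, f, \<rho>'). lax_endo K \<rho> \<and> lax_endo K \<rho>' \<and>
             f \<in> J \<and> f \<in> Hom K (Dom K \<rho>) (Dom K \<rho>') \<and> f \<cdot>\<^bsub>K\<^esub> \<rho> \<preceq>\<^bsub>K\<^esub> \<rho>' \<cdot>\<^bsub>K\<^esub> f},
     Dom = (\<lambda>(\<rho>, f, \<rho>'). \<rho>),
     Cod = (\<lambda>(\<rho>, f, \<rho>'). \<rho>'),
     Idt = (\<lambda>\<rho>. (\<rho>, Idt K (Dom K \<rho>), \<rho>)),
     Comp = (\<lambda>(_, g, \<rho>'') (\<rho>, f, _). (\<rho>, g \<cdot>\<^bsub>K\<^esub> f, \<rho>'')),
     Le = (\<lambda>(_, f, _) (_, g, _). f \<preceq>\<^bsub>K\<^esub> g)\<rparr>"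

definition change_of_base ::
  "('d, 'e, 'k) cat_scheme \<Rightarrow> ('o, 'a, 'm) ocat_scheme \<Rightarrow>
   ('a, 'a \<times> 'a \<times> 'a, ('d, 'e, 'o, 'a) mapping,
    ('d, 'e, 'o, 'a) mapping \<times> ('d \<Rightarrow> 'a) \<times> ('d, 'e, 'o, 'a) mapping) mapping" where
  "change_of_base D K =
    (let const = (\<lambda>\<rho>. \<lparr>omap = \<lambda>X\<in>Obj D. Dom K \<rho>, amap = \<lambda>d\<in>Arr D. \<rho>\<rparr>)
     in \<lparr>omap = const, amap = (\<lambda>(\<rho>, f, \<rho>'). (const \<rho>, \<lambda>X\<in>Obj D. f, const \<rho>'))\<rparr>)"


section \<open>The functor \<open>\<Sigma>\<^sub>!\<close>\<close>

text \<open>In this section \<open>S\<close> and \<open>\<iota>\<close> are a choice of \<open>Obj D\<close>-indexed coproducts.\<close>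

definition overline ::
  "('d, 'e, 'k) cat_scheme \<Rightarrow> ('o, 'a, 'm) ocat_scheme \<Rightarrow>
   (('d \<Rightarrow> 'o) \<Rightarrow> 'o) \<Rightarrow> (('d \<Rightarrow> 'o) \<Rightarrow> 'd \<Rightarrow> 'a) \<Rightarrow> ('d, 'e, 'o, 'a) mapping \<Rightarrow> 'e \<Rightarrow> 'a" where
  "overline D K S \<iota> \<pi> d =
    (let X = S (omap \<pi>); i = \<iota> (omap \<pi>)
     in cotuple K (Obj D) X i X
          (\<lambda>A. if A = Dom D d then i (Cod D d) \<cdot>\<^bsub>K\<^esub> amap \<pi> d else i A))"

text \<open>The join of \<open>k \<ge> 1\<close> arrows depends only on their set, so the lists \<open>d\<^sub>1, \<dots>, d\<^sub>k\<close> become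
  finite nonempty sets \<open>B\<close>.\<close>

definition finite_joins ::
  "('d, 'e, 'k) cat_scheme \<Rightarrow> ('o, 'a, 'm) ocat_scheme \<Rightarrow>
   (('d \<Rightarrow> 'o) \<Rightarrow> 'o) \<Rightarrow> (('d \<Rightarrow> 'o) \<Rightarrow> 'd \<Rightarrow> 'a) \<Rightarrow> ('d, 'e, 'o, 'a) mapping \<Rightarrow> 'a set" where
  "finite_joins D K S \<iota> \<pi> =
    {\<Squnion>\<^bsub>Hom_poset K (S (omap \<pi>)) (S (omap \<pi>))\<^esub> (overline D K S \<iota> \<pi> ` B) | B.
       finite B \<and> B \<noteq> {} \<and> B \<subseteq> Arr D}"

text \<open>If \<open>D\<close> is empty, \<open>finite_joins\<close> is empty, but then \<open>S (omap \<pi>)\<close> is initial and the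
  supremum of the empty set in its one-element endomorphism poset exists.\<close>

definition Sigma_bang_obj ::
  "('d, 'e, 'k) cat_scheme \<Rightarrow> ('o, 'a, 'm) ocat_scheme \<Rightarrow>
   (('d \<Rightarrow> 'o) \<Rightarrow> 'o) \<Rightarrow> (('d \<Rightarrow> 'o) \<Rightarrow> 'd \<Rightarrow> 'a) \<Rightarrow> ('d, 'e, 'o, 'a) mapping \<Rightarrow> 'a" where
  "Sigma_bang_obj D K S \<iota> \<pi> =
    (let X = S (omap \<pi>); L = Hom_poset K X X; p = \<Squnion>\<^bsub>L\<^esub> (finite_joins D K S \<iota> \<pi>)
     in \<Squnion>\<^bsub>L\<^esub> (range (\<lambda>l::nat. ((\<lambda>g. p \<cdot>\<^bsub>K\<^esub> g) ^^ l) (Idt K X))))"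

definition Sigma_bang ::
  "('d, 'e, 'k) cat_scheme \<Rightarrow> ('o, 'a, 'm) ocat_scheme \<Rightarrow>
   (('d \<Rightarrow> 'o) \<Rightarrow> 'o) \<Rightarrow> (('d \<Rightarrow> 'o) \<Rightarrow> 'd \<Rightarrow> 'a) \<Rightarrow>
   (('d, 'e, 'o, 'a) mapping,
    ('d, 'e, 'o, 'a) mapping \<times> ('d \<Rightarrow> 'a) \<times> ('d, 'e, 'o, 'a) mapping,
    'a, 'a \<times> 'a \<times> 'a) mapping" where
  "Sigma_bang D K S \<iota> =
    \<lparr>omap = Sigma_bang_obj D K S \<iota>,
     amap = (\<lambda>(\<pi>, f, \<pi>').
       (Sigma_bang_obj D K S \<iota> \<pi>,
        cotuple K (Obj D) (S (omap \<pi>)) (\<iota> (omap \<pi>)) (S (omap \<pi>'))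
          (\<lambda>A. \<iota> (omap \<pi>') A \<cdot>\<^bsub>K\<^esub> f A),
        Sigma_bang_obj D K S \<iota> \<pi>'))\<rparr>"

end

theory Submission
  imports Defs
begin

text \<open>
  Let \<open>X = \<Sum>\<^sub>D \<pi> D\<close>, let \<open>\<rho>\<close> be a lax endomorphism of \<open>Y\<close> and \<open>g : X \<rightarrow> Y\<close>.
  Everything rests on the equivalence of \<open>g \<circ> \<Sigma>\<^sub>! \<pi> \<le> \<rho> \<circ> g\<close> with oplaxity of the family
  \<open>g \<circ> in\<^sub>D\<close>. From left to right one restricts along \<open>in\<^sub>D\<close>, using that \<open>\<Sigma>\<^sub>! \<pi>\<close> dominates every
  \<open>overline d\<close>. From right to left, oplaxity and \<open>id \<le> \<rho>\<close> give \<open>g \<circ> overline d \<le> \<rho> \<circ> g\<close> on each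
  summand, hence on \<open>X\<close> because cotupling preserves the order. Left distributivity extends this
  inequality to finite joins and continuity to \<open>\<Squnion>\<Pi>\<close>; then \<open>\<rho> \<circ> \<rho> \<le> \<rho>\<close> extends it to
  the powers of \<open>\<Squnion>\<Pi>\<close>, and continuity to their supremum. The universal property of the coproduct now makes
  \<open>g \<mapsto> (g \<circ> in\<^sub>D)\<^sub>D\<close> the required isomorphism of hom-posets.
\<close>

section \<open>Suprema in hom-posets\<close>

lemma is_coproductD:
  assumes "is_coproduct C I F X i"
  shows "X \<in> Obj C" "A \<in> I \<Longrightarrow> F A \<in> Obj C" "A \<in> I \<Longrightarrow> i A \<in> Hom C (F A) X"
    "Z \<in> Obj C \<Longrightarrow> (\<And>A. A \<in> I \<Longrightarrow> f A \<in> Hom C (F A) Z) \<Longrightarrow>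
      \<exists>!h. h \<in> Hom C X Z \<and> (\<forall>A\<in>I. h \<cdot>\<^bsub>C\<^esub> i A = f A)"
  using assms by (simp_all add: is_coproduct_def)

lemma cotuple_prop:
  assumes "is_coproduct C I F X i" "Z \<in> Obj C" "\<And>A. A \<in> I \<Longrightarrow> f A \<in> Hom C (F A) Z"
  shows "cotuple C I X i Z f \<in> Hom C X Z \<and> (\<forall>A\<in>I. cotuple C I X i Z f \<cdot>\<^bsub>C\<^esub> i A = f A)"
  unfolding cotuple_def by (rule theI', rule is_coproductD(4)) (fact assms)+

lemmas cotuple_Hom = cotuple_prop [THEN conjunct1]
  and cotuple_inj = cotuple_prop [THEN conjunct2, rule_format]

context category
begin

lemma Hom_ObjD: "f \<in> Hom C X Y \<Longrightarrow> X \<in> Obj C" "f \<in> Hom C X Y \<Longrightarrow> Y \<in> Obj C"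
  using Dom_closed Cod_closed by (auto simp: Hom_def)

text \<open>This is the uniqueness half of the universal property. The typing of \<open>f\<close> is
  inherited from \<open>h\<close>, and taking \<open>f A\<close> to be \<open>h \<cdot> i A\<close>
  exhibits any arrow out of the coproduct as the cotuple of its own restrictions.\<close>

lemma cotuple_eqI:
  assumes "is_coproduct C I F X i" "h \<in> Hom C X Z" "\<And>A. A \<in> I \<Longrightarrow> h \<cdot> i A = f A"
  shows "cotuple C I X i Z f = h"
proof -
  have "f A \<in> Hom C (F A) Z" if "A \<in> I" for A
    using Comp_in_Hom [OF is_coproductD(3) [OF assms(1) that] assms(2)] assms(3) [OF that] by simp
  from is_coproductD(4) [OF assms(1) Hom_ObjD(2) [OF assms(2)] this]
  show ?thesis
    unfolding cotuple_def by (rule the1_equality) (use assms in auto)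
qed

end

section \<open>Order reasoning and suprema in a single hom-poset\<close>

context order_category
begin

lemma Hom_partial_order': "f \<in> Hom K X Y \<Longrightarrow> partial_order (Hom_poset K X Y)"
  using Hom_partial_order Hom_ObjD by blast

lemma Le_refl:
  assumes "f \<in> Hom K X Y" shows "f \<preceq> f"
proof -
  interpret L: partial_order "Hom_poset K X Y"
    using assms by (rule Hom_partial_order')
  show ?thesis
    using L.le_refl [of f] assms by (simp add: Hom_poset_def)
qed

lemma Le_antisym:
  assumes "f \<preceq> g" "g \<preceq> f" "f \<in> Hom K X Y" "g \<in> Hom K X Y" shows "f = g"
proof -
  interpret L: partial_order "Hom_poset K X Y"
    using assms(3) by (rule Hom_partial_order')
  show ?thesis
    using L.le_antisym [of f g] assms by (simp add: Hom_poset_def)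
qed

lemma Le_trans:
  assumes "f \<preceq> g" "g \<preceq> h" "f \<in> Hom K X Y" "g \<in> Hom K X Y" "h \<in> Hom K X Y" shows "f \<preceq> h"
proof -
  interpret L: partial_order "Hom_poset K X Y"
    using assms(3) by (rule Hom_partial_order')
  show ?thesis
    using L.le_trans [of f g h] assms by (simp add: Hom_poset_def)
qed

lemma Comp_mono_left:
  "f \<in> Hom K X Y \<Longrightarrow> g \<in> Hom K Y Z \<Longrightarrow> g' \<in> Hom K Y Z \<Longrightarrow> g \<preceq> g' \<Longrightarrow> g \<cdot> f \<preceq> g' \<cdot> f"
  using Comp_mono Le_refl by blast

lemma Comp_mono_right:
  "f \<in> Hom K X Y \<Longrightarrow> f' \<in> Hom K X Y \<Longrightarrow> g \<in> Hom K Y Z \<Longrightarrow> f \<preceq> f' \<Longrightarrow> g \<cdot> f \<preceq> g \<cdot> f'"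
  using Comp_mono Le_refl by blast

text \<open>\<open>Upper\<close> tests a bound only against members of the carrier, so the inclusion
  of \<open>A\<close> in the hom-set is what lets the bounds range over all of
  \<open>A\<close>.\<close>

lemma least_Upper_Hom_iff:
  assumes "A \<subseteq> Hom K X Y"
  shows "least (Hom_poset K X Y) s (Upper (Hom_poset K X Y) A) \<longleftrightarrow>
    s \<in> Hom K X Y \<and> (\<forall>a\<in>A. a \<preceq> s) \<and> (\<forall>u\<in>Hom K X Y. (\<forall>a\<in>A. a \<preceq> u) \<longrightarrow> s \<preceq> u)"
proof -
  have "Upper (Hom_poset K X Y) A = {u \<in> Hom K X Y. \<forall>a\<in>A. a \<preceq> u}"
    using assms by (auto simp: Upper_def Hom_poset_def)
  then show ?thesis
    by (auto simp: least_def Hom_poset_def)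
qed

text \<open>\<open>\<Squnion>\<close> is a choice among the least upper bounds, and antisymmetry
  leaves only one. A supremum is therefore always handled by first exhibiting a least upper
  bound.\<close>

lemma Hom_sup_eqI:
  assumes "least (Hom_poset K X Y) s (Upper (Hom_poset K X Y) A)"
  shows "\<Squnion>\<^bsub>Hom_poset K X Y\<^esub> A = s"
proof -
  have "s \<in> Hom K X Y"
    using assms by (auto simp: least_def Upper_def Hom_poset_def)
  then interpret L: partial_order "Hom_poset K X Y"
    by (rule Hom_partial_order')
  show ?thesis
    unfolding sup_def by (rule some_equality, rule assms) (rule L.least_unique [OF _ assms])
qed

end

section \<open>Composition with finite joins and with directed suprema\<close>

context left_distributive_dcpo_join_category
begin

text \<open>Induction on \<open>A\<close>: inserting \<open>b\<close> replaces the supremum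
  \<open>s\<close> by the binary join of \<open>b\<close> and \<open>s\<close>, and left
  distributivity splits \<open>h\<close> over that join. Existence and compatibility with
  \<open>h\<close> are proved together because the second depends on how the supremum was built. The
  bound \<open>u\<close> stands in for the join of the composites
  \<open>h \<cdot> a\<close>.\<close>

lemma Comp_finite_join_le:
  assumes "finite A" "A \<noteq> {}" "A \<subseteq> Hom K X Y"
  shows "\<exists>s. least (Hom_poset K X Y) s (Upper (Hom_poset K X Y) A) \<and>
    (\<forall>Z. \<forall>h\<in>Hom K Y Z. \<forall>u\<in>Hom K X Z. (\<forall>a\<in>A. h \<cdot> a \<preceq> u) \<longrightarrow> h \<cdot> s \<preceq> u)"
  using assms
proof (induction A rule: finite_ne_induct)
  case (singleton a)
  then show ?case
    by (intro exI [of _ a]) (auto simp: least_Upper_Hom_iff Le_refl)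
next
  case (insert b A)
  from insert obtain s where
    s: "least (Hom_poset K X Y) s (Upper (Hom_poset K X Y) A)"
    and s_le: "\<And>Z h u. h \<in> Hom K Y Z \<Longrightarrow> u \<in> Hom K X Z \<Longrightarrow> (\<And>a. a \<in> A \<Longrightarrow> h \<cdot> a \<preceq> u) \<Longrightarrow> h \<cdot> s \<preceq> u"
    by fastforce
  have A: "A \<subseteq> Hom K X Y" and b: "b \<in> Hom K X Y"
    using insert.prems by auto
  have sH: "s \<in> Hom K X Y"
    using s A by (simp add: least_Upper_Hom_iff)
  \<comment> \<open>The semilattice axiom supplies only the existence of a least upper bound of two
    arrows; uniqueness identifies it with the \<open>\<squnion>\<close> of the distributivity
    law.\<close>
  have join: "least (Hom_poset K X' Y') (f \<squnion>\<^bsub>Hom_poset K X' Y'\<^esub> g) (Upper (Hom_poset K X' Y') {f, g})"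
    if fg: "f \<in> Hom K X' Y'" "g \<in> Hom K X' Y'" for f g X' Y'
  proof -
    interpret L: upper_semilattice "Hom_poset K X' Y'"
      using fg Hom_joins Hom_ObjD by blast
    obtain t where "least (Hom_poset K X' Y') t (Upper (Hom_poset K X' Y') {f, g})"
      using L.sup_of_two_exists [of f g] fg
      by (auto simp: Hom_poset_def)
    then show ?thesis
      using Hom_sup_eqI unfolding join_def by metis
  qed
  let ?j = "b \<squnion>\<^bsub>Hom_poset K X Y\<^esub> s"
  have j: "?j \<in> Hom K X Y" "b \<preceq> ?j" "s \<preceq> ?j"
      "\<And>u. u \<in> Hom K X Y \<Longrightarrow> b \<preceq> u \<Longrightarrow> s \<preceq> u \<Longrightarrow> ?j \<preceq> u"
    using join [OF b sH] b sH by (auto simp: least_Upper_Hom_iff)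
  have "least (Hom_poset K X Y) ?j (Upper (Hom_poset K X Y) (insert b A))"
    using s j A b by (auto simp: least_Upper_Hom_iff intro: Le_trans [of _ s _ X Y])
  moreover have "h \<cdot> ?j \<preceq> u"
    if h: "h \<in> Hom K Y Z" and u: "u \<in> Hom K X Z" and le: "\<And>a. a \<in> insert b A \<Longrightarrow> h \<cdot> a \<preceq> u" for Z h u
  proof -
    have H: "h \<cdot> b \<in> Hom K X Z" "h \<cdot> s \<in> Hom K X Z"
      using Comp_in_Hom b sH h by auto
    have "(h \<cdot> b) \<squnion>\<^bsub>Hom_poset K X Z\<^esub> (h \<cdot> s) \<preceq> u"
      using join [OF H] H u le s_le [OF h u] by (auto simp: least_Upper_Hom_iff)
    then show ?thesis
      using left_distrib [OF b sH h] by simp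
  qed
  ultimately show ?case
    by blast
qed

lemma finite_join_props:
  assumes "finite A" "A \<noteq> {}" "A \<subseteq> Hom K X Y"
  shows finite_join_Hom: "\<Squnion>\<^bsub>Hom_poset K X Y\<^esub> A \<in> Hom K X Y"
    and finite_join_upper: "a \<in> A \<Longrightarrow> a \<preceq> \<Squnion>\<^bsub>Hom_poset K X Y\<^esub> A"
    and finite_join_least: "u \<in> Hom K X Y \<Longrightarrow> (\<And>a. a \<in> A \<Longrightarrow> a \<preceq> u) \<Longrightarrow> \<Squnion>\<^bsub>Hom_poset K X Y\<^esub> A \<preceq> u"
    and Comp_finite_join_least: "h \<in> Hom K Y Z \<Longrightarrow> v \<in> Hom K X Z \<Longrightarrow>
      (\<And>a. a \<in> A \<Longrightarrow> h \<cdot> a \<preceq> v) \<Longrightarrow> h \<cdot> \<Squnion>\<^bsub>Hom_poset K X Y\<^esub> A \<preceq> v"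
proof -
  obtain s where s: "least (Hom_poset K X Y) s (Upper (Hom_poset K X Y) A)"
    and s_le: "\<forall>Z. \<forall>h\<in>Hom K Y Z. \<forall>u\<in>Hom K X Z. (\<forall>a\<in>A. h \<cdot> a \<preceq> u) \<longrightarrow> h \<cdot> s \<preceq> u"
    using Comp_finite_join_le [OF assms] by blast
  note eq = Hom_sup_eqI [OF s]
  show "\<Squnion>\<^bsub>Hom_poset K X Y\<^esub> A \<in> Hom K X Y" "a \<in> A \<Longrightarrow> a \<preceq> \<Squnion>\<^bsub>Hom_poset K X Y\<^esub> A"
    "u \<in> Hom K X Y \<Longrightarrow> (\<And>a. a \<in> A \<Longrightarrow> a \<preceq> u) \<Longrightarrow> \<Squnion>\<^bsub>Hom_poset K X Y\<^esub> A \<preceq> u"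
    using s assms(3) by (auto simp: eq least_Upper_Hom_iff)
  show "h \<in> Hom K Y Z \<Longrightarrow> v \<in> Hom K X Z \<Longrightarrow>
      (\<And>a. a \<in> A \<Longrightarrow> h \<cdot> a \<preceq> v) \<Longrightarrow> h \<cdot> \<Squnion>\<^bsub>Hom_poset K X Y\<^esub> A \<preceq> v"
    using s_le by (simp add: eq)
qed

text \<open>Continuity in either variable is put in the form in which it is used: a common bound on
  the composites with the members of \<open>A\<close> is a bound on the composite with the
  supremum.\<close>

lemma directed_sup_props:
  assumes dir: "directed_in (Hom_poset K X Y) A"
  shows directed_sup_Hom: "\<Squnion>\<^bsub>Hom_poset K X Y\<^esub> A \<in> Hom K X Y"
    and directed_sup_upper: "a \<in> A \<Longrightarrow> a \<preceq> \<Squnion>\<^bsub>Hom_poset K X Y\<^esub> A"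
    and Comp_directed_sup_least: "h \<in> Hom K Y Z \<Longrightarrow> v \<in> Hom K X Z \<Longrightarrow>
      (\<And>a. a \<in> A \<Longrightarrow> h \<cdot> a \<preceq> v) \<Longrightarrow> h \<cdot> \<Squnion>\<^bsub>Hom_poset K X Y\<^esub> A \<preceq> v"
    and directed_sup_Comp_least: "k \<in> Hom K W X \<Longrightarrow> w \<in> Hom K W Y \<Longrightarrow>
      (\<And>a. a \<in> A \<Longrightarrow> a \<cdot> k \<preceq> w) \<Longrightarrow> \<Squnion>\<^bsub>Hom_poset K X Y\<^esub> A \<cdot> k \<preceq> w"
proof -
  have A: "A \<subseteq> Hom K X Y" "A \<noteq> {}"
    using dir by (auto simp: directed_in_def Hom_poset_def)
  \<comment> \<open>A directed set is nonempty, so one of its arrows certifies that \<open>X\<close>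
    and \<open>Y\<close> are objects.\<close>
  then have XY: "X \<in> Obj K" "Y \<in> Obj K"
    using Hom_ObjD by blast+
  obtain s where s: "least (Hom_poset K X Y) s (Upper (Hom_poset K X Y) A)"
    using Hom_directed_sup [OF XY dir] by blast
  note eq = Hom_sup_eqI [OF s]
  show "\<Squnion>\<^bsub>Hom_poset K X Y\<^esub> A \<in> Hom K X Y" "a \<in> A \<Longrightarrow> a \<preceq> \<Squnion>\<^bsub>Hom_poset K X Y\<^esub> A"
    using s A by (auto simp: eq least_Upper_Hom_iff)
  show "h \<cdot> \<Squnion>\<^bsub>Hom_poset K X Y\<^esub> A \<preceq> v"
    if h: "h \<in> Hom K Y Z" and "v \<in> Hom K X Z" "\<And>a. a \<in> A \<Longrightarrow> h \<cdot> a \<preceq> v"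
  proof -
    have "(\<lambda>f. h \<cdot> f) ` A \<subseteq> Hom K X Z"
      using A h Comp_in_Hom by blast
    then show ?thesis
      using Comp_directed_sup_right [OF h XY(1) dir s] that
      by (simp add: eq least_Upper_Hom_iff)
  qed
  show "\<Squnion>\<^bsub>Hom_poset K X Y\<^esub> A \<cdot> k \<preceq> w"
    if k: "k \<in> Hom K W X" and "w \<in> Hom K W Y" "\<And>a. a \<in> A \<Longrightarrow> a \<cdot> k \<preceq> w"
  proof -
    have "(\<lambda>f. f \<cdot> k) ` A \<subseteq> Hom K W Y"
      using A k Comp_in_Hom by blast
    then show ?thesis
      using Comp_directed_sup_left [OF k XY(2) dir s] that
      by (simp add: eq least_Upper_Hom_iff)
  qed
qed

end


section \<open>The lax endomorphism of a lax functor\<close>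

lemma subcat_simps [simp]:
  "Obj (subcat C J) = Obj C" "Comp (subcat C J) = Comp C" "Idt (subcat C J) = Idt C"
  "Arr (subcat C J) = J" "Dom (subcat C J) = Dom C" "Cod (subcat C J) = Cod C"
  by (simp_all add: subcat_def)

lemma (in wide_subcategory) Hom_subcat: "Hom (subcat K J) X Y = J \<inter> Hom K X Y"
  using sub_Arr by (auto simp: Hom_def)

lemma lax_functorD:
  assumes "lax_functor D K \<pi>"
  shows "A \<in> Obj D \<Longrightarrow> omap \<pi> A \<in> Obj K"
    and "omap \<pi> \<in> Obj D \<rightarrow>\<^sub>E Obj K"
    and "d \<in> Arr D \<Longrightarrow> amap \<pi> d \<in> Hom K (omap \<pi> (Dom D d)) (omap \<pi> (Cod D d))"
    and "A \<in> Obj D \<Longrightarrow> Idt K (omap \<pi> A) \<preceq>\<^bsub>K\<^esub> amap \<pi> (Idt D A)"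
  using assms unfolding lax_functor_def by auto

lemma oplax_transformationD:
  assumes "oplax_transformation D K J \<pi> \<pi>' f"
  shows "f \<in> extensional (Obj D)"
    and "A \<in> Obj D \<Longrightarrow> f A \<in> J"
    and "A \<in> Obj D \<Longrightarrow> f A \<in> Hom K (omap \<pi> A) (omap \<pi>' A)"
    and "d \<in> Arr D \<Longrightarrow> f (Cod D d) \<cdot>\<^bsub>K\<^esub> amap \<pi> d \<preceq>\<^bsub>K\<^esub> amap \<pi>' d \<cdot>\<^bsub>K\<^esub> f (Dom D d)"
  using assms unfolding oplax_transformation_def by auto

locale oplax_setting = D: category D + order_category K + wide_subcategory K J
  for D :: "('d, 'e, 'k) cat_scheme" and K :: "('o, 'a, 'm) ocat_scheme" (structure)
    and J :: "'a set"

text \<open>The coproducts are chosen in \<open>J\<close>, which places the injections and the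
  cotuples of \<open>J\<close>-arrows in \<open>J\<close>; \<open>preserves\<close> makes the same
  cocones coproducts in \<open>K\<close>.\<close>

locale sigma_bang_setting = oplax_setting D K J + left_distributive_dcpo_join_category K
  for D :: "('d, 'e, 'k) cat_scheme" and K :: "('o, 'a, 'm) ocat_scheme" (structure)
    and J :: "'a set" +
  fixes S :: "('d \<Rightarrow> 'o) \<Rightarrow> 'o" and \<iota> :: "('d \<Rightarrow> 'o) \<Rightarrow> 'd \<Rightarrow> 'a"
  assumes preserves: "inclusion_preserves_coproducts K J (Obj D)"
    and cotupling: "cotupling_preserves_order K (Obj D)"
    and choice: "coproduct_choice (subcat K J) (Obj D) S \<iota>"
begin

text \<open>Each arrow is the cotuple of its restrictions, so order preservation by cotupling makes
  the injections jointly order-reflecting. Comparisons of arrows out of the coproduct can thus be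
  checked summand by summand.\<close>

lemma coproduct_Hom_leI:
  assumes c: "is_coproduct K (Obj D) F X i" and h: "h \<in> Hom K X Z" "h' \<in> Hom K X Z"
    and le: "\<And>A. A \<in> Obj D \<Longrightarrow> h \<cdot> i A \<preceq> h' \<cdot> i A"
  shows "h \<preceq> h'"
proof -
  have "\<forall>A\<in>Obj D. h \<cdot> i A \<in> Hom K (F A) Z \<and> h' \<cdot> i A \<in> Hom K (F A) Z \<and> h \<cdot> i A \<preceq> h' \<cdot> i A"
    using h le is_coproductD(3) [OF c] by (auto intro: Comp_in_Hom)
  moreover have "Z \<in> Obj K"
    using h Hom_ObjD by blast
  ultimately have "cotuple K (Obj D) X i Z (\<lambda>A. h \<cdot> i A) \<preceq> cotuple K (Obj D) X i Z (\<lambda>A. h' \<cdot> i A)"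
    using cotupling [unfolded cotupling_preserves_order_def, rule_format, OF lepoll_refl c] by simp
  then show ?thesis
    using cotuple_eqI [OF c h(1)] cotuple_eqI [OF c h(2)] by simp
qed

section \<open>The coproduct of the values of a lax functor\<close>

context
  fixes \<pi> :: "('d, 'e, 'o, 'a) mapping"
  assumes \<pi>: "lax_functor D K \<pi>"
begin

lemma coproduct_sub: "is_coproduct (subcat K J) (Obj D) (omap \<pi>) (S (omap \<pi>)) (\<iota> (omap \<pi>))"
  using choice lax_functorD(2) [OF \<pi>] by (auto simp: coproduct_choice_def)

lemma coproduct: "is_coproduct K (Obj D) (omap \<pi>) (S (omap \<pi>)) (\<iota> (omap \<pi>))"
  using coproduct_sub preserves by (auto simp: inclusion_preserves_coproducts_def)

lemma coproduct_Hom_eqI: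
  assumes "h \<in> Hom K (S (omap \<pi>)) Z" "h' \<in> Hom K (S (omap \<pi>)) Z"
    and "\<And>A. A \<in> Obj D \<Longrightarrow> h \<cdot> \<iota> (omap \<pi>) A = h' \<cdot> \<iota> (omap \<pi>) A"
  shows "h = h'"
  using cotuple_eqI [OF coproduct assms(1,3)] cotuple_eqI [OF coproduct assms(2)] by simp

lemma S_Obj: "S (omap \<pi>) \<in> Obj K"
  using is_coproductD(1) [OF coproduct] .

lemma inj_Hom: "A \<in> Obj D \<Longrightarrow> \<iota> (omap \<pi>) A \<in> Hom K (omap \<pi> A) (S (omap \<pi>))"
  using is_coproductD(3) [OF coproduct] .

lemma inj_in_J: "A \<in> Obj D \<Longrightarrow> \<iota> (omap \<pi>) A \<in> J"
  using is_coproductD(3) [OF coproduct_sub] by (auto simp: Hom_subcat)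

text \<open>The cotuple taken in the subcategory satisfies the equations that determine the cotuple
  in \<open>K\<close>, so the two coincide.\<close>

lemma cotuple_in_J:
  assumes "Z \<in> Obj K" "\<And>A. A \<in> Obj D \<Longrightarrow> f A \<in> J"
    "\<And>A. A \<in> Obj D \<Longrightarrow> f A \<in> Hom K (omap \<pi> A) Z"
  shows "cotuple K (Obj D) (S (omap \<pi>)) (\<iota> (omap \<pi>)) Z f \<in> J"
proof -
  let ?h = "cotuple (subcat K J) (Obj D) (S (omap \<pi>)) (\<iota> (omap \<pi>)) Z f"
  have f: "f A \<in> Hom (subcat K J) (omap \<pi> A) Z" if "A \<in> Obj D" for A
    using assms that by (simp add: Hom_subcat)
  have h: "?h \<in> J \<inter> Hom K (S (omap \<pi>)) Z"
    using cotuple_Hom [OF coproduct_sub _ f] assms(1) by (simp add: Hom_subcat)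
  have "cotuple K (Obj D) (S (omap \<pi>)) (\<iota> (omap \<pi>)) Z f = ?h"
    by (rule cotuple_eqI [OF coproduct])
      (use h cotuple_inj [OF coproduct_sub _ f] assms(1) in simp_all)
  then show ?thesis
    using h by simp
qed

section \<open>The arrows \<open>overline D K S \<iota> \<pi> d\<close> on the summands\<close>

lemma overline_Hom_inj:
  assumes d: "d \<in> Arr D"
  shows overline_Hom: "overline D K S \<iota> \<pi> d \<in> Hom K (S (omap \<pi>)) (S (omap \<pi>))"
    and overline_inj: "A \<in> Obj D \<Longrightarrow> overline D K S \<iota> \<pi> d \<cdot> \<iota> (omap \<pi>) A =
      (if A = Dom D d then \<iota> (omap \<pi>) (Cod D d) \<cdot> amap \<pi> d else \<iota> (omap \<pi>) A)"
proof -
  let ?f = "\<lambda>A. if A = Dom D d then \<iota> (omap \<pi>) (Cod D d) \<cdot> amap \<pi> d else \<iota> (omap \<pi>) A"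
  have f: "?f A \<in> Hom K (omap \<pi> A) (S (omap \<pi>))" if "A \<in> Obj D" for A
    using that inj_Hom lax_functorD(3) [OF \<pi> d] D.Cod_closed [OF d] by (auto intro: Comp_in_Hom)
  show "overline D K S \<iota> \<pi> d \<in> Hom K (S (omap \<pi>)) (S (omap \<pi>))"
    using cotuple_Hom [OF coproduct S_Obj f] by (simp add: overline_def Let_def)
  show "A \<in> Obj D \<Longrightarrow> overline D K S \<iota> \<pi> d \<cdot> \<iota> (omap \<pi>) A = ?f A"
    using cotuple_inj [OF coproduct S_Obj f] by (simp add: overline_def Let_def)
qed

section \<open>The supremum of \<Pi> and its powers\<close>

definition "Pi_sup = \<Squnion>\<^bsub>Hom_poset K (S (omap \<pi>)) (S (omap \<pi>))\<^esub> (finite_joins D K S \<iota> \<pi>)"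

definition "Pi_power l = ((\<lambda>g. Pi_sup \<cdot> g) ^^ l) (Idt K (S (omap \<pi>)))"

lemma Sigma_bang_obj_eq:
  "Sigma_bang_obj D K S \<iota> \<pi> = \<Squnion>\<^bsub>Hom_poset K (S (omap \<pi>)) (S (omap \<pi>))\<^esub> (range Pi_power)"
  by (simp add: Sigma_bang_obj_def Let_def Pi_sup_def Pi_power_def [abs_def])

text \<open>Two finite joins are bounded by the join over the union of their index sets. The
  assumption supplies a first join: with no arrows, \<Pi> is empty and hence not directed.\<close>

lemma directed_finite_joins:
  assumes "Arr D \<noteq> {}"
  shows "directed_in (Hom_poset K (S (omap \<pi>)) (S (omap \<pi>))) (finite_joins D K S \<iota> \<pi>)"
proof -
  let ?L = "Hom_poset K (S (omap \<pi>)) (S (omap \<pi>))" and ?o = "overline D K S \<iota> \<pi>"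
  have o: "finite (?o ` B)" "?o ` B \<noteq> {}" "?o ` B \<subseteq> Hom K (S (omap \<pi>)) (S (omap \<pi>))"
    if "finite B" "B \<noteq> {}" "B \<subseteq> Arr D" for B
    using that overline_Hom by auto
  have mono: "\<Squnion>\<^bsub>?L\<^esub> (?o ` B) \<preceq> \<Squnion>\<^bsub>?L\<^esub> (?o ` B')"
    if "B \<noteq> {}" "B \<subseteq> B'" "finite B'" "B' \<subseteq> Arr D" for B B'
  proof (rule finite_join_least)
    have B': "B' \<noteq> {}" and B: "finite B" "B \<subseteq> Arr D"
      using that by (auto intro: finite_subset)
    note o' = o [OF that(3) B' that(4)]
    show "finite (?o ` B)" "?o ` B \<noteq> {}" "?o ` B \<subseteq> Hom K (S (omap \<pi>)) (S (omap \<pi>))"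
      using o [OF B(1) that(1) B(2)] by auto
    show "\<Squnion>\<^bsub>?L\<^esub> (?o ` B') \<in> Hom K (S (omap \<pi>)) (S (omap \<pi>))"
      by (rule finite_join_Hom [OF o'])
    show "a \<preceq> \<Squnion>\<^bsub>?L\<^esub> (?o ` B')" if "a \<in> ?o ` B" for a
      by (rule finite_join_upper [OF o']) (use that \<open>B \<subseteq> B'\<close> in blast)
  qed
  show ?thesis
    unfolding directed_in_def
  proof (intro conjI ballI)
    show "finite_joins D K S \<iota> \<pi> \<subseteq> carrier ?L"
      using finite_join_Hom [OF o] by (auto simp: finite_joins_def Hom_poset_def)
    obtain d where "d \<in> Arr D"
      using assms by blast
    then have "\<Squnion>\<^bsub>?L\<^esub> (?o ` {d}) \<in> finite_joins D K S \<iota> \<pi>"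
      unfolding finite_joins_def by blast
    then show "finite_joins D K S \<iota> \<pi> \<noteq> {}"
      by blast
  next
    fix a b assume "a \<in> finite_joins D K S \<iota> \<pi>" "b \<in> finite_joins D K S \<iota> \<pi>"
    then obtain A B where
      A: "a = \<Squnion>\<^bsub>?L\<^esub> (?o ` A)" "finite A" "A \<noteq> {}" "A \<subseteq> Arr D" and
      B: "b = \<Squnion>\<^bsub>?L\<^esub> (?o ` B)" "finite B" "B \<noteq> {}" "B \<subseteq> Arr D"
      unfolding finite_joins_def by blast
    have "\<Squnion>\<^bsub>?L\<^esub> (?o ` (A \<union> B)) \<in> finite_joins D K S \<iota> \<pi>"
      unfolding finite_joins_def using A B by blast
    moreover have "a \<preceq> \<Squnion>\<^bsub>?L\<^esub> (?o ` (A \<union> B))" "b \<preceq> \<Squnion>\<^bsub>?L\<^esub> (?o ` (A \<union> B))"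
      using A B by (auto intro!: mono)
    ultimately show "\<exists>c\<in>finite_joins D K S \<iota> \<pi>. a \<sqsubseteq>\<^bsub>?L\<^esub> c \<and> b \<sqsubseteq>\<^bsub>?L\<^esub> c"
      by (auto simp: Hom_poset_def)
  qed
qed

lemma empty_Obj: "Arr D = {} \<Longrightarrow> Obj D = {}"
  using D.Idt_in_Hom by (auto simp: Hom_def)

text \<open>A category with no arrows has no objects, and the coproduct of the empty family is
  initial. This settles the case in which \<Pi> is empty.\<close>

lemma coproduct_Hom_eq_empty:
  assumes "Arr D = {}" "g \<in> Hom K (S (omap \<pi>)) Z" "h \<in> Hom K (S (omap \<pi>)) Z"
  shows "g = h"
  by (rule coproduct_Hom_eqI [OF assms(2,3)]) (simp add: empty_Obj assms(1))

lemma Pi_sup_Hom: "Pi_sup \<in> Hom K (S (omap \<pi>)) (S (omap \<pi>))"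
proof (cases "Arr D = {}")
  case True
  have id: "Idt K (S (omap \<pi>)) \<in> Hom K (S (omap \<pi>)) (S (omap \<pi>))"
    using Idt_in_Hom S_Obj by blast
  have fj: "finite_joins D K S \<iota> \<pi> = {}"
    using True by (auto simp: finite_joins_def)
  \<comment> \<open>The endomorphism poset has a single element here, so the identity is a least
    upper bound of the empty set and the value of \<open>\<Squnion>\<close> is determined.\<close>
  have "least (Hom_poset K (S (omap \<pi>)) (S (omap \<pi>))) (Idt K (S (omap \<pi>)))
      (Upper (Hom_poset K (S (omap \<pi>)) (S (omap \<pi>))) (finite_joins D K S \<iota> \<pi>))"
    unfolding fj least_Upper_Hom_iff [OF empty_subsetI]
    using id Le_refl [OF id] coproduct_Hom_eq_empty [OF True id] by blast
  from Hom_sup_eqI [OF this] id show ?thesis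
    by (simp add: Pi_sup_def)
next
  case False
  show ?thesis
    unfolding Pi_sup_def by (rule directed_sup_Hom [OF directed_finite_joins [OF False]])
qed

lemma overline_le_Pi_sup:
  assumes d: "d \<in> Arr D"
  shows "overline D K S \<iota> \<pi> d \<preceq> Pi_sup"
proof -
  let ?L = "Hom_poset K (S (omap \<pi>)) (S (omap \<pi>))"
  have ne: "Arr D \<noteq> {}"
    using d by auto
  have o: "finite (overline D K S \<iota> \<pi> ` {d})" "overline D K S \<iota> \<pi> ` {d} \<noteq> {}"
      "overline D K S \<iota> \<pi> ` {d} \<subseteq> Hom K (S (omap \<pi>)) (S (omap \<pi>))"
    using overline_Hom d by auto
  have "\<Squnion>\<^bsub>?L\<^esub> (overline D K S \<iota> \<pi> ` {d}) \<in> finite_joins D K S \<iota> \<pi>"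
    unfolding finite_joins_def using d by blast
  then have "\<Squnion>\<^bsub>?L\<^esub> (overline D K S \<iota> \<pi> ` {d}) \<preceq> Pi_sup"
    unfolding Pi_sup_def by (rule directed_sup_upper [OF directed_finite_joins [OF ne]])
  moreover have "overline D K S \<iota> \<pi> d \<preceq> \<Squnion>\<^bsub>?L\<^esub> (overline D K S \<iota> \<pi> ` {d})"
    by (rule finite_join_upper [OF o]) simp
  ultimately show ?thesis
    using Le_trans [OF _ _ overline_Hom [OF d] finite_join_Hom [OF o] Pi_sup_Hom] by blast
qed

text \<open>If there is an object \<open>A\<close>, then \<open>overline\<close> at
  \<open>Idt D A\<close> dominates the identity: on the summand \<open>A\<close> by the unit law of
  \<open>\<pi>\<close>, on the other summands with equality. Otherwise the coproduct is
  initial.\<close>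

lemma Idt_le_Pi_sup: "Idt K (S (omap \<pi>)) \<preceq> Pi_sup"
proof (cases "Arr D = {}")
  case True
  then show ?thesis
    using coproduct_Hom_eq_empty [OF True Idt_in_Hom [OF S_Obj] Pi_sup_Hom] Le_refl [OF Pi_sup_Hom]
    by simp
next
  case False
  then obtain A where A: "A \<in> Obj D"
    using D.Dom_closed by blast
  have d: "Idt D A \<in> Arr D" "Dom D (Idt D A) = A" "Cod D (Idt D A) = A"
    using D.Idt_in_Hom [OF A] by (auto simp: Hom_def)
  have "Idt K (S (omap \<pi>)) \<preceq> overline D K S \<iota> \<pi> (Idt D A)"
  proof (rule coproduct_Hom_leI [OF coproduct])
    show "Idt K (S (omap \<pi>)) \<cdot> \<iota> (omap \<pi>) B \<preceq> overline D K S \<iota> \<pi> (Idt D A) \<cdot> \<iota> (omap \<pi>) B"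
      if B: "B \<in> Obj D" for B
    proof (cases "B = A")
      case True
      have "\<iota> (omap \<pi>) A \<cdot> Idt K (omap \<pi> A) \<preceq> \<iota> (omap \<pi>) A \<cdot> amap \<pi> (Idt D A)"
        by (rule Comp_mono_right)
          (use lax_functorD(3) [OF \<pi> d(1)] lax_functorD(1,4) [OF \<pi> A] inj_Hom A d
            Idt_in_Hom in auto)
      then show ?thesis
        using True A overline_inj [OF d(1)] d inj_Hom [OF A]
        by (simp add: Comp_Idt_left Comp_Idt_right)
    next
      case False
      then show ?thesis
        using B overline_inj [OF d(1)] d inj_Hom [OF B]
        by (simp add: Comp_Idt_left Le_refl)
    qed
  qed (use Idt_in_Hom S_Obj overline_Hom d in auto)
  then show ?thesis
    using overline_le_Pi_sup [OF d(1)] Idt_in_Hom [OF S_Obj] overline_Hom [OF d(1)] Pi_sup_Hom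
    by (rule Le_trans)
qed

text \<open>The bound passes first through the finite joins by left distributivity and then through
  the directed supremum by continuity; if \<Pi> is empty, initiality decides.\<close>

lemma Comp_Pi_sup_le:
  assumes h: "h \<in> Hom K (S (omap \<pi>)) Z" and u: "u \<in> Hom K (S (omap \<pi>)) Z"
    and le: "\<And>d. d \<in> Arr D \<Longrightarrow> h \<cdot> overline D K S \<iota> \<pi> d \<preceq> u"
  shows "h \<cdot> Pi_sup \<preceq> u"
proof (cases "Arr D = {}")
  case True
  then show ?thesis
    using coproduct_Hom_eq_empty [OF True Comp_in_Hom [OF Pi_sup_Hom h] u] Le_refl [OF u] by simp
next
  case False
  show ?thesis
    unfolding Pi_sup_def
  proof (rule Comp_directed_sup_least [OF directed_finite_joins [OF False] h u])
    fix a assume "a \<in> finite_joins D K S \<iota> \<pi>"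
    then obtain B where B: "finite B" "B \<noteq> {}" "B \<subseteq> Arr D"
      and a: "a = \<Squnion>\<^bsub>Hom_poset K (S (omap \<pi>)) (S (omap \<pi>))\<^esub> (overline D K S \<iota> \<pi> ` B)"
      unfolding finite_joins_def by blast
    show "h \<cdot> a \<preceq> u"
      unfolding a by (rule Comp_finite_join_least) (use B overline_Hom h u le in auto)
  qed
qed

lemma Pi_power_0: "Pi_power 0 = Idt K (S (omap \<pi>))"
  and Pi_power_Suc: "Pi_power (Suc l) = Pi_sup \<cdot> Pi_power l"
  by (simp_all add: Pi_power_def)

lemma Pi_power_Hom: "Pi_power l \<in> Hom K (S (omap \<pi>)) (S (omap \<pi>))"
  by (induction l) (auto simp: Pi_power_0 Pi_power_Suc S_Obj intro: Idt_in_Hom Comp_in_Hom Pi_sup_Hom)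

lemma Pi_power_add: "Pi_power m \<cdot> Pi_power l = Pi_power (m + l)"
proof (induction m)
  case (Suc m)
  then show ?case
    using Comp_assoc [OF Pi_power_Hom Pi_power_Hom Pi_sup_Hom] by (simp add: Pi_power_Suc)
qed (simp add: Pi_power_0 Comp_Idt_left [OF Pi_power_Hom])

text \<open>Composing \<open>Idt K (S (omap \<pi>)) \<preceq> Pi_sup\<close> with a power on the
  right gives one step of the chain. Monotonicity is what makes the set of powers directed.\<close>

lemma Pi_power_mono: "l \<le> m \<Longrightarrow> Pi_power l \<preceq> Pi_power m"
proof (induction m rule: dec_induct)
  case (step m)
  have "Pi_power m \<preceq> Pi_power (Suc m)"
    using Comp_mono_left [OF Pi_power_Hom [of m] Idt_in_Hom [OF S_Obj] Pi_sup_Hom Idt_le_Pi_sup]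
    by (simp add: Pi_power_Suc Comp_Idt_left [OF Pi_power_Hom])
  with step.IH show ?case
    using Pi_power_Hom Pi_power_Hom Pi_power_Hom by (rule Le_trans)
qed (simp add: Le_refl [OF Pi_power_Hom])

lemma directed_Pi_power: "directed_in (Hom_poset K (S (omap \<pi>)) (S (omap \<pi>))) (range Pi_power)"
proof -
  have "Pi_power l \<preceq> Pi_power (max l m)" "Pi_power m \<preceq> Pi_power (max l m)" for l m
    by (simp_all add: Pi_power_mono)
  then show ?thesis
    using Pi_power_Hom by (fastforce simp: directed_in_def Hom_poset_def)
qed

section \<open>The supremum of the powers as a lax endomorphism\<close>

lemma Sigma_bang_obj_Hom: "Sigma_bang_obj D K S \<iota> \<pi> \<in> Hom K (S (omap \<pi>)) (S (omap \<pi>))"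
  unfolding Sigma_bang_obj_eq by (rule directed_sup_Hom [OF directed_Pi_power])

lemma Pi_power_le_Sigma: "Pi_power l \<preceq> Sigma_bang_obj D K S \<iota> \<pi>"
  unfolding Sigma_bang_obj_eq by (rule directed_sup_upper [OF directed_Pi_power]) simp

lemma overline_le_Sigma:
  assumes "d \<in> Arr D" shows "overline D K S \<iota> \<pi> d \<preceq> Sigma_bang_obj D K S \<iota> \<pi>"
  \<comment> \<open>The powers start from the identity, so \<open>Pi_sup\<close> itself is the power
    with index one.\<close>
  using Pi_power_le_Sigma [of "Suc 0"] overline_le_Pi_sup [OF assms]
  by (simp add: Pi_power_Suc Pi_power_0 Comp_Idt_right [OF Pi_sup_Hom])
    (rule Le_trans [OF _ _ overline_Hom [OF assms] Pi_sup_Hom Sigma_bang_obj_Hom])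

lemma Comp_Sigma_le:
  assumes "h \<in> Hom K (S (omap \<pi>)) Z" "v \<in> Hom K (S (omap \<pi>)) Z" "\<And>l. h \<cdot> Pi_power l \<preceq> v"
  shows "h \<cdot> Sigma_bang_obj D K S \<iota> \<pi> \<preceq> v"
  unfolding Sigma_bang_obj_eq
  by (rule Comp_directed_sup_least [OF directed_Pi_power]) (use assms in auto)

lemma Sigma_Comp_le:
  assumes "k \<in> Hom K W (S (omap \<pi>))" "v \<in> Hom K W (S (omap \<pi>))" "\<And>l. Pi_power l \<cdot> k \<preceq> v"
  shows "Sigma_bang_obj D K S \<iota> \<pi> \<cdot> k \<preceq> v"
  unfolding Sigma_bang_obj_eq
  by (rule directed_sup_Comp_least [OF directed_Pi_power]) (use assms in auto)

text \<open>Continuity, applied to the left factor for a fixed power on the right and then to the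
  right factor, reduces the composite to products of two powers, which are again powers. The unit
  inequality comes from the zeroth power.\<close>

lemma lax_endo_Sigma: "lax_endo K (Sigma_bang_obj D K S \<iota> \<pi>)"
proof -
  let ?s = "Sigma_bang_obj D K S \<iota> \<pi>"
  have "?s \<cdot> Pi_power l \<preceq> ?s" for l
    by (rule Sigma_Comp_le [OF Pi_power_Hom Sigma_bang_obj_Hom]) (simp add: Pi_power_add Pi_power_le_Sigma)
  then have "?s \<cdot> ?s \<preceq> ?s"
    by (rule Comp_Sigma_le [OF Sigma_bang_obj_Hom Sigma_bang_obj_Hom])
  then show ?thesis
    using Sigma_bang_obj_Hom Pi_power_le_Sigma [of 0] by (auto simp: lax_endo_def Hom_def Pi_power_0)
qed

text \<open>This is the transposition of the adjunction in terms of arrows of \<open>K\<close>: up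
  to membership in \<open>J\<close>, the left side makes \<open>g\<close> a morphism of lax
  endomorphisms, and the right side makes its restrictions an oplax transformation into the constant
  lax functor at \<open>\<rho>\<close>.\<close>

lemma Comp_Sigma_le_iff:
  assumes g: "g \<in> Hom K (S (omap \<pi>)) (Dom K \<rho>)" and \<rho>: "lax_endo K \<rho>"
  shows "g \<cdot> Sigma_bang_obj D K S \<iota> \<pi> \<preceq> \<rho> \<cdot> g \<longleftrightarrow>
    (\<forall>d\<in>Arr D. (g \<cdot> \<iota> (omap \<pi>) (Cod D d)) \<cdot> amap \<pi> d \<preceq> \<rho> \<cdot> (g \<cdot> \<iota> (omap \<pi>) (Dom D d)))"
    (is "?L \<longleftrightarrow> ?R")
proof -
  let ?X = "S (omap \<pi>)" and ?Y = "Dom K \<rho>" and ?i = "\<iota> (omap \<pi>)" and ?s = "Sigma_bang_obj D K S \<iota> \<pi>"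
    and ?o = "overline D K S \<iota> \<pi>"
  have \<rho>H: "\<rho> \<in> Hom K ?Y ?Y" and \<rho>_id: "Idt K ?Y \<preceq> \<rho>" and \<rho>_idem: "\<rho> \<cdot> \<rho> \<preceq> \<rho>"
    using \<rho> by (auto simp: lax_endo_def Hom_def)
  have \<rho>g: "\<rho> \<cdot> g \<in> Hom K ?X ?Y"
    using g \<rho>H Comp_in_Hom by blast
  \<comment> \<open>On the summand \<open>Dom D d\<close> the arrow \<open>?o d\<close> acts as
    \<open>amap \<pi> d\<close> followed by an injection. This links restriction along that summand
    with the left side of oplaxity in both directions.\<close>
  have go: "(g \<cdot> ?o d) \<cdot> ?i (Dom D d) = (g \<cdot> ?i (Cod D d)) \<cdot> amap \<pi> d" if d: "d \<in> Arr D" for d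
  proof -
    have "(g \<cdot> ?o d) \<cdot> ?i (Dom D d) = g \<cdot> (?i (Cod D d) \<cdot> amap \<pi> d)"
      using Comp_assoc [OF inj_Hom overline_Hom g, of "Dom D d" d] overline_inj [OF d, of "Dom D d"]
        D.Dom_closed [OF d] d by simp
    then show ?thesis
      using Comp_assoc [OF lax_functorD(3) [OF \<pi> d] inj_Hom g] D.Cod_closed [OF d] by simp
  qed
  show ?thesis
  proof
    assume L: ?L
    show ?R
    proof
      fix d assume d: "d \<in> Arr D"
      note i = inj_Hom [OF D.Dom_closed [OF d]]
      have H: "g \<cdot> ?o d \<in> Hom K ?X ?Y" "g \<cdot> ?s \<in> Hom K ?X ?Y"
        using Comp_in_Hom overline_Hom [OF d] Sigma_bang_obj_Hom g by auto
      \<comment> \<open>The bound on \<open>g \<cdot> ?s\<close> descends to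
        \<open>g \<cdot> ?o d\<close>, and restricting it to the summand \<open>Dom D d\<close>
        yields oplaxity at \<open>d\<close>.\<close>
      have "g \<cdot> ?o d \<preceq> g \<cdot> ?s"
        by (rule Comp_mono_right [OF overline_Hom [OF d] Sigma_bang_obj_Hom g overline_le_Sigma [OF d]])
      then have "g \<cdot> ?o d \<preceq> \<rho> \<cdot> g"
        using L H \<rho>g by (rule Le_trans)
      then have "(g \<cdot> ?o d) \<cdot> ?i (Dom D d) \<preceq> (\<rho> \<cdot> g) \<cdot> ?i (Dom D d)"
        by (rule Comp_mono_left [OF i H(1) \<rho>g])
      then show "(g \<cdot> ?i (Cod D d)) \<cdot> amap \<pi> d \<preceq> \<rho> \<cdot> (g \<cdot> ?i (Dom D d))"
        using go [OF d] Comp_assoc [OF i g \<rho>H] by simp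
    qed
  next
    assume R: ?R
    \<comment> \<open>On the summand \<open>Dom D d\<close> this is oplaxity at \<open>d\<close>; on
      every other summand \<open>?o d\<close> acts as the identity and the inequality comes from
      \<open>\<rho>_id\<close>.\<close>
    have "g \<cdot> ?o d \<preceq> \<rho> \<cdot> g" if d: "d \<in> Arr D" for d
    proof (rule coproduct_Hom_leI [OF coproduct _ \<rho>g])
      show "g \<cdot> ?o d \<in> Hom K ?X ?Y"
        using Comp_in_Hom overline_Hom [OF d] g by blast
      fix A assume A: "A \<in> Obj D"
      note i = inj_Hom [OF A] and gi = Comp_in_Hom [OF inj_Hom [OF A] g]
      show "(g \<cdot> ?o d) \<cdot> ?i A \<preceq> (\<rho> \<cdot> g) \<cdot> ?i A"
      proof (cases "A = Dom D d")
        case True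
        then show ?thesis
          using R d go [OF d] Comp_assoc [OF i g \<rho>H] by simp
      next
        case False
        have "Idt K ?Y \<cdot> (g \<cdot> ?i A) \<preceq> \<rho> \<cdot> (g \<cdot> ?i A)"
          by (rule Comp_mono_left [OF gi _ \<rho>H \<rho>_id]) (use Idt_in_Hom Hom_ObjD(1) [OF \<rho>H] in blast)
        then show ?thesis
          using False overline_inj [OF d A] Comp_assoc [OF i overline_Hom [OF d] g]
            Comp_assoc [OF i g \<rho>H] Comp_Idt_left [OF gi] by simp
      qed
    qed
    then have gp: "g \<cdot> Pi_sup \<preceq> \<rho> \<cdot> g"
      by (rule Comp_Pi_sup_le [OF g \<rho>g])
    \<comment> \<open>The bound has to be the same for all \<open>l\<close>. In the successor case
      \<open>gp\<close> replaces \<open>g \<cdot> Pi_sup\<close> by \<open>\<rho> \<cdot> g\<close>,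
      the induction hypothesis produces a second \<open>\<rho>\<close>, and
      \<open>\<rho>_idem\<close> absorbs it.\<close>
    have "g \<cdot> Pi_power l \<preceq> \<rho> \<cdot> g" for l
    proof (induction l)
      case 0
      have "Idt K ?Y \<cdot> g \<preceq> \<rho> \<cdot> g"
        by (rule Comp_mono_left [OF g _ \<rho>H \<rho>_id]) (use Idt_in_Hom Hom_ObjD(1) [OF \<rho>H] in blast)
      then show ?case
        by (simp add: Pi_power_0 Comp_Idt_left [OF g] Comp_Idt_right [OF g])
    next
      case (Suc l)
      note p = Pi_sup_Hom and l = Pi_power_Hom [of l]
      have gl: "g \<cdot> Pi_power l \<in> Hom K ?X ?Y"
        using Comp_in_Hom l g by blast
      have \<rho>gl: "\<rho> \<cdot> (g \<cdot> Pi_power l) \<in> Hom K ?X ?Y"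
        by (rule Comp_in_Hom [OF gl \<rho>H])
      have gpl: "(g \<cdot> Pi_sup) \<cdot> Pi_power l \<in> Hom K ?X ?Y"
        by (rule Comp_in_Hom [OF l Comp_in_Hom [OF p g]])
      have "(g \<cdot> Pi_sup) \<cdot> Pi_power l \<preceq> \<rho> \<cdot> (g \<cdot> Pi_power l)"
        using Comp_mono_left [OF l Comp_in_Hom [OF p g] \<rho>g gp] Comp_assoc [OF l g \<rho>H] by simp
      moreover have "\<rho> \<cdot> (g \<cdot> Pi_power l) \<preceq> \<rho> \<cdot> g"
      proof (rule Le_trans [OF _ _ \<rho>gl Comp_in_Hom [OF \<rho>g \<rho>H] \<rho>g])
        show "\<rho> \<cdot> (g \<cdot> Pi_power l) \<preceq> \<rho> \<cdot> (\<rho> \<cdot> g)"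
          by (rule Comp_mono_right [OF gl \<rho>g \<rho>H Suc])
        show "\<rho> \<cdot> (\<rho> \<cdot> g) \<preceq> \<rho> \<cdot> g"
          using Comp_mono_left [OF g Comp_in_Hom [OF \<rho>H \<rho>H] \<rho>H \<rho>_idem] Comp_assoc [OF g \<rho>H \<rho>H]
          by simp
      qed
      ultimately show ?case
        using Le_trans [OF _ _ gpl \<rho>gl \<rho>g] Comp_assoc [OF l p g] by (simp add: Pi_power_Suc)
    qed
    then show ?L
      by (rule Comp_Sigma_le [OF g \<rho>g])
  qed
qed

end

end


section \<open>The order-enriched categories of lax functors\<close>

lemma lax_cat_simps:
  "Obj (lax_cat D K J) = {\<pi>. lax_functor D K \<pi>}"
  "Idt (lax_cat D K J) \<pi> = (\<pi>, \<lambda>X\<in>Obj D. Idt K (omap \<pi> X), \<pi>)"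
  "(\<pi>1, g, \<pi>2) \<cdot>\<^bsub>lax_cat D K J\<^esub> (\<pi>3, f, \<pi>4) = (\<pi>3, \<lambda>X\<in>Obj D. g X \<cdot>\<^bsub>K\<^esub> f X, \<pi>2)"
  "(\<pi>1, f, \<pi>2) \<preceq>\<^bsub>lax_cat D K J\<^esub> (\<pi>3, g, \<pi>4) \<longleftrightarrow> (\<forall>X\<in>Obj D. f X \<preceq>\<^bsub>K\<^esub> g X)"
  by (simp_all add: lax_cat_def)

lemma lax_endo_cat_simps:
  "Obj (lax_endo_cat K J) = {\<rho>. lax_endo K \<rho>}"
  "Idt (lax_endo_cat K J) \<rho> = (\<rho>, Idt K (Dom K \<rho>), \<rho>)"
  "(\<rho>1, g, \<rho>2) \<cdot>\<^bsub>lax_endo_cat K J\<^esub> (\<rho>3, f, \<rho>4) = (\<rho>3, g \<cdot>\<^bsub>K\<^esub> f, \<rho>2)"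
  "(\<rho>1, f, \<rho>2) \<preceq>\<^bsub>lax_endo_cat K J\<^esub> (\<rho>3, g, \<rho>4) \<longleftrightarrow> f \<preceq>\<^bsub>K\<^esub> g"
  by (simp_all add: lax_endo_cat_def)

lemma Hom_lax_cat:
  "t \<in> Hom (lax_cat D K J) \<pi> \<pi>' \<longleftrightarrow> (\<exists>f. t = (\<pi>, f, \<pi>') \<and> lax_functor D K \<pi> \<and>
    lax_functor D K \<pi>' \<and> oplax_transformation D K J \<pi> \<pi>' f)"
  by (auto simp: Hom_def lax_cat_def)

lemma Hom_lax_endo_cat:
  "t \<in> Hom (lax_endo_cat K J) \<rho> \<rho>' \<longleftrightarrow> (\<exists>f. t = (\<rho>, f, \<rho>') \<and> lax_endo K \<rho> \<and> lax_endo K \<rho>' \<and>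
    f \<in> J \<and> f \<in> Hom K (Dom K \<rho>) (Dom K \<rho>') \<and> f \<cdot>\<^bsub>K\<^esub> \<rho> \<preceq>\<^bsub>K\<^esub> \<rho>' \<cdot>\<^bsub>K\<^esub> f)"
  by (auto simp: Hom_def lax_endo_cat_def)

lemma lax_endoD:
  assumes "lax_endo K \<rho>"
  shows "\<rho> \<in> Hom K (Dom K \<rho>) (Dom K \<rho>)" "Idt K (Dom K \<rho>) \<preceq>\<^bsub>K\<^esub> \<rho>" "\<rho> \<cdot>\<^bsub>K\<^esub> \<rho> \<preceq>\<^bsub>K\<^esub> \<rho>"
  using assms by (auto simp: lax_endo_def Hom_def)

lemma partial_order_Hom_posetI:
  assumes "\<And>f. f \<in> Hom C X Y \<Longrightarrow> f \<preceq>\<^bsub>C\<^esub> f"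
    and "\<And>f g. f \<in> Hom C X Y \<Longrightarrow> g \<in> Hom C X Y \<Longrightarrow> f \<preceq>\<^bsub>C\<^esub> g \<Longrightarrow> g \<preceq>\<^bsub>C\<^esub> f \<Longrightarrow> f = g"
    and "\<And>f g h. f \<in> Hom C X Y \<Longrightarrow> g \<in> Hom C X Y \<Longrightarrow> h \<in> Hom C X Y \<Longrightarrow>
      f \<preceq>\<^bsub>C\<^esub> g \<Longrightarrow> g \<preceq>\<^bsub>C\<^esub> h \<Longrightarrow> f \<preceq>\<^bsub>C\<^esub> h"
  shows "partial_order (Hom_poset C X Y)"
proof unfold_locales
  let ?P = "Hom_poset C X Y"
  show "x \<sqsubseteq>\<^bsub>?P\<^esub> x" if "x \<in> carrier ?P" for x
    using assms(1) [of x] that by (simp add: Hom_poset_def)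
  show "x .=\<^bsub>?P\<^esub> y" if "x \<sqsubseteq>\<^bsub>?P\<^esub> y" "y \<sqsubseteq>\<^bsub>?P\<^esub> x" "x \<in> carrier ?P" "y \<in> carrier ?P" for x y
    using assms(2) [of x y] that by (simp add: Hom_poset_def)
  show "x \<sqsubseteq>\<^bsub>?P\<^esub> z" if "x \<sqsubseteq>\<^bsub>?P\<^esub> y" "y \<sqsubseteq>\<^bsub>?P\<^esub> z"
    "x \<in> carrier ?P" "y \<in> carrier ?P" "z \<in> carrier ?P" for x y z
    using assms(3) [of x y z] that by (simp add: Hom_poset_def)
qed (simp_all add: Hom_poset_def)

context wide_subcategory
begin

lemma Comp_in_J: "f \<in> J \<Longrightarrow> g \<in> J \<Longrightarrow> f \<in> Hom K X Y \<Longrightarrow> g \<in> Hom K Y Z \<Longrightarrow> g \<cdot> f \<in> J"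
  using sub_Comp by (auto simp: Hom_def)

end

context order_category
begin

text \<open>Two squares that commute up to an inequality are pasted. The arrows \<open>f\<close> and
  \<open>f'\<close> may differ because an oplax transformation contributes its components at the
  source and at the target of \<open>d\<close>; for morphisms of lax endomorphisms they
  coincide.\<close>

lemma lax_square_Comp:
  assumes H: "\<sigma> \<in> Hom K A A'" "\<sigma>' \<in> Hom K B B'" "\<sigma>'' \<in> Hom K C C'"
      "f \<in> Hom K A B" "f' \<in> Hom K A' B'" "g \<in> Hom K B C" "g' \<in> Hom K B' C'"
    and f: "f' \<cdot> \<sigma> \<preceq> \<sigma>' \<cdot> f" and g: "g' \<cdot> \<sigma>' \<preceq> \<sigma>'' \<cdot> g"
  shows "(g' \<cdot> f') \<cdot> \<sigma> \<preceq> \<sigma>'' \<cdot> (g \<cdot> f)"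
proof (rule Le_trans)
  note C = Comp_in_Hom [OF H(1,5)] Comp_in_Hom [OF H(4,2)] Comp_in_Hom [OF H(2,7)] Comp_in_Hom [OF H(6,3)]
    Comp_in_Hom [OF H(4,6)] Comp_in_Hom [OF H(5,7)]
  show "(g' \<cdot> f') \<cdot> \<sigma> \<preceq> (g' \<cdot> \<sigma>') \<cdot> f"
    using Comp_mono_right [OF C(1,2) H(7) f]
    by (simp add: Comp_assoc [OF H(1,5,7)] Comp_assoc [OF H(4,2,7)])
  show "(g' \<cdot> \<sigma>') \<cdot> f \<preceq> \<sigma>'' \<cdot> (g \<cdot> f)"
    using Comp_mono_left [OF H(4) C(3,4) g] by (simp add: Comp_assoc [OF H(4,6,3)])
  show "(g' \<cdot> f') \<cdot> \<sigma> \<in> Hom K A C'" "(g' \<cdot> \<sigma>') \<cdot> f \<in> Hom K A C'" "\<sigma>'' \<cdot> (g \<cdot> f) \<in> Hom K A C'"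
    by (rule Comp_in_Hom [OF H(1) C(6)] Comp_in_Hom [OF H(4) C(3)] Comp_in_Hom [OF C(5) H(3)])+
qed

end

section \<open>Verification of the order-enriched category axioms\<close>

context oplax_setting
begin

lemma oplax_transformation_Idt:
  assumes "lax_functor D K \<pi>"
  shows "oplax_transformation D K J \<pi> \<pi> (\<lambda>X\<in>Obj D. Idt K (omap \<pi> X))"
  unfolding oplax_transformation_def
proof (intro conjI ballI)
  fix d assume d: "d \<in> Arr D"
  note H = lax_functorD(3) [OF assms d]
  show "(\<lambda>X\<in>Obj D. Idt K (omap \<pi> X)) (Cod D d) \<cdot> amap \<pi> d \<preceq>
      amap \<pi> d \<cdot> (\<lambda>X\<in>Obj D. Idt K (omap \<pi> X)) (Dom D d)"
    using D.Dom_closed [OF d] D.Cod_closed [OF d]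
    by (simp add: Comp_Idt_left [OF H] Comp_Idt_right [OF H] Le_refl [OF H])
qed (simp_all add: Idt_in_Hom sub_Idt lax_functorD(1) [OF assms])

lemma oplax_transformation_Comp:
  assumes \<pi>: "lax_functor D K \<pi>" "lax_functor D K \<pi>'" "lax_functor D K \<pi>''"
    and f: "oplax_transformation D K J \<pi> \<pi>' f" and g: "oplax_transformation D K J \<pi>' \<pi>'' g"
  shows "oplax_transformation D K J \<pi> \<pi>'' (\<lambda>X\<in>Obj D. g X \<cdot> f X)"
proof -
  have "(g (Cod D d) \<cdot> f (Cod D d)) \<cdot> amap \<pi> d \<preceq> amap \<pi>'' d \<cdot> (g (Dom D d) \<cdot> f (Dom D d))"
    if d: "d \<in> Arr D" for d
    using D.Dom_closed [OF d] D.Cod_closed [OF d]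
    by (rule_tac lax_square_Comp [OF lax_functorD(3) [OF \<pi>(1) d] lax_functorD(3) [OF \<pi>(2) d]
          lax_functorD(3) [OF \<pi>(3) d]])
      (auto intro: oplax_transformationD [OF f] oplax_transformationD [OF g] d)
  moreover have "g A \<cdot> f A \<in> J" "g A \<cdot> f A \<in> Hom K (omap \<pi> A) (omap \<pi>'' A)" if "A \<in> Obj D" for A
    using that oplax_transformationD(2,3) [OF f that] oplax_transformationD(2,3) [OF g that]
    by (simp_all add: Comp_in_J Comp_in_Hom)
  ultimately show ?thesis
    by (simp add: oplax_transformation_def D.Dom_closed D.Cod_closed)
qed

lemma order_category_lax_cat: "order_category (lax_cat D K J)"
proof (intro order_category.intro category.intro order_category_axioms.intro)
  let ?L = "lax_cat D K J"
  show "Dom ?L t \<in> Obj ?L" "Cod ?L t \<in> Obj ?L" if "t \<in> Arr ?L" for t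
    using that by (auto simp: lax_cat_def)
  show "Idt ?L \<pi> \<in> Hom ?L \<pi> \<pi>" if "\<pi> \<in> Obj ?L" for \<pi>
    using that oplax_transformation_Idt by (auto simp: Hom_lax_cat lax_cat_simps)
  show "t' \<cdot>\<^bsub>?L\<^esub> t \<in> Hom ?L \<pi> \<pi>''" if "t \<in> Hom ?L \<pi> \<pi>'" "t' \<in> Hom ?L \<pi>' \<pi>''" for t t' \<pi> \<pi>' \<pi>''
    using that oplax_transformation_Comp by (auto simp: Hom_lax_cat lax_cat_simps)
  show "(t3 \<cdot>\<^bsub>?L\<^esub> t2) \<cdot>\<^bsub>?L\<^esub> t1 = t3 \<cdot>\<^bsub>?L\<^esub> (t2 \<cdot>\<^bsub>?L\<^esub> t1)"
    if "t1 \<in> Hom ?L \<pi>0 \<pi>1" "t2 \<in> Hom ?L \<pi>1 \<pi>2" "t3 \<in> Hom ?L \<pi>2 \<pi>3" for t1 t2 t3 \<pi>0 \<pi>1 \<pi>2 \<pi>3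
    using that Comp_assoc [OF oplax_transformationD(3) oplax_transformationD(3) oplax_transformationD(3)]
    by (auto simp: Hom_lax_cat lax_cat_simps intro!: restrict_ext)
  show "t \<cdot>\<^bsub>?L\<^esub> Idt ?L \<pi> = t" "Idt ?L \<pi>' \<cdot>\<^bsub>?L\<^esub> t = t" if tH: "t \<in> Hom ?L \<pi> \<pi>'" for t \<pi> \<pi>'
  proof -
    obtain f where t: "t = (\<pi>, f, \<pi>')" and f: "oplax_transformation D K J \<pi> \<pi>' f"
      using tH by (auto simp: Hom_lax_cat)
    \<comment> \<open>Both sides of an identity law are extensional on \<open>Obj D\<close>, so
      agreement of the components there already gives equality.\<close>
    note ext = extensionalityI [OF restrict_extensional oplax_transformationD(1) [OF f]]
    show "t \<cdot>\<^bsub>?L\<^esub> Idt ?L \<pi> = t" "Idt ?L \<pi>' \<cdot>\<^bsub>?L\<^esub> t = t"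
      using Comp_Idt_left [OF oplax_transformationD(3) [OF f]]
        Comp_Idt_right [OF oplax_transformationD(3) [OF f]]
      by (auto simp: t lax_cat_simps intro!: ext)
  qed
  show "partial_order (Hom_poset ?L \<pi> \<pi>')" for \<pi> \<pi>'
  proof (rule partial_order_Hom_posetI)
    show "t \<preceq>\<^bsub>?L\<^esub> t" if "t \<in> Hom ?L \<pi> \<pi>'" for t
      using that Le_refl [OF oplax_transformationD(3)] by (auto simp: Hom_lax_cat lax_cat_simps)
    show "t = t'"
      if t: "t \<in> Hom ?L \<pi> \<pi>'" "t' \<in> Hom ?L \<pi> \<pi>'" and le: "t \<preceq>\<^bsub>?L\<^esub> t'" "t' \<preceq>\<^bsub>?L\<^esub> t" for t t'
    proof -
      obtain f g where f: "t = (\<pi>, f, \<pi>')" "oplax_transformation D K J \<pi> \<pi>' f"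
        and g: "t' = (\<pi>, g, \<pi>')" "oplax_transformation D K J \<pi> \<pi>' g"
        using t by (auto simp: Hom_lax_cat)
      have "f A = g A" if A: "A \<in> Obj D" for A
        by (rule Le_antisym [OF _ _ oplax_transformationD(3) [OF f(2) A] oplax_transformationD(3) [OF g(2) A]])
          (use le A in \<open>simp_all add: f g lax_cat_simps\<close>)
      then show ?thesis
        using extensionalityI [OF oplax_transformationD(1) [OF f(2)] oplax_transformationD(1) [OF g(2)]]
        by (simp add: f g)
    qed
    show "t \<preceq>\<^bsub>?L\<^esub> t''" if "t \<in> Hom ?L \<pi> \<pi>'" "t' \<in> Hom ?L \<pi> \<pi>'" "t'' \<in> Hom ?L \<pi> \<pi>'"
      "t \<preceq>\<^bsub>?L\<^esub> t'" "t' \<preceq>\<^bsub>?L\<^esub> t''" for t t' t''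
      using that Le_trans [OF _ _ oplax_transformationD(3) oplax_transformationD(3) oplax_transformationD(3)]
      by (fastforce simp: Hom_lax_cat lax_cat_simps)
  qed
  show "g \<cdot>\<^bsub>?L\<^esub> f \<preceq>\<^bsub>?L\<^esub> g' \<cdot>\<^bsub>?L\<^esub> f'"
    if H: "f \<in> Hom ?L \<pi> \<pi>'" "f' \<in> Hom ?L \<pi> \<pi>'" "g \<in> Hom ?L \<pi>' \<pi>''" "g' \<in> Hom ?L \<pi>' \<pi>''"
      and le: "f \<preceq>\<^bsub>?L\<^esub> f'" "g \<preceq>\<^bsub>?L\<^esub> g'" for f f' g g' \<pi> \<pi>' \<pi>''
  proof -
    obtain u u' v v' where
      u: "f = (\<pi>, u, \<pi>')" "oplax_transformation D K J \<pi> \<pi>' u" and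
      u': "f' = (\<pi>, u', \<pi>')" "oplax_transformation D K J \<pi> \<pi>' u'" and
      v: "g = (\<pi>', v, \<pi>'')" "oplax_transformation D K J \<pi>' \<pi>'' v" and
      v': "g' = (\<pi>', v', \<pi>'')" "oplax_transformation D K J \<pi>' \<pi>'' v'"
      using H by (auto simp: Hom_lax_cat)
    have "v A \<cdot> u A \<preceq> v' A \<cdot> u' A" if A: "A \<in> Obj D" for A
      using oplax_transformationD(3) [OF u(2) A] oplax_transformationD(3) [OF u'(2) A]
        oplax_transformationD(3) [OF v(2) A] oplax_transformationD(3) [OF v'(2) A]
      by (rule Comp_mono) (use le A in \<open>simp_all add: u u' v v' lax_cat_simps\<close>)
    then show ?thesis
      by (simp add: u u' v v' lax_cat_simps)
  qed
qed

lemma order_category_lax_endo_cat: "order_category (lax_endo_cat K J)"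
proof (intro order_category.intro category.intro order_category_axioms.intro)
  let ?L = "lax_endo_cat K J"
  show "Dom ?L t \<in> Obj ?L" "Cod ?L t \<in> Obj ?L" if "t \<in> Arr ?L" for t
    using that by (auto simp: lax_endo_cat_def)
  show "Idt ?L \<rho> \<in> Hom ?L \<rho> \<rho>" if "\<rho> \<in> Obj ?L" for \<rho>
  proof -
    have \<rho>: "lax_endo K \<rho>"
      using that by (simp add: lax_endo_cat_simps)
    note H = lax_endoD(1) [OF \<rho>]
    show ?thesis
      using \<rho> Hom_ObjD(1) [OF H] by (auto simp: Hom_lax_endo_cat lax_endo_cat_simps
          Comp_Idt_left [OF H] Comp_Idt_right [OF H] Le_refl [OF H] sub_Idt Idt_in_Hom)
  qed
  show "t' \<cdot>\<^bsub>?L\<^esub> t \<in> Hom ?L \<rho> \<rho>''"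
    if t: "t \<in> Hom ?L \<rho> \<rho>'" and t': "t' \<in> Hom ?L \<rho>' \<rho>''" for t t' \<rho> \<rho>' \<rho>''
  proof -
    obtain f g where \<rho>: "lax_endo K \<rho>" "lax_endo K \<rho>'" "lax_endo K \<rho>''"
      and f: "t = (\<rho>, f, \<rho>')" "f \<in> J" "f \<in> Hom K (Dom K \<rho>) (Dom K \<rho>')" "f \<cdot> \<rho> \<preceq> \<rho>' \<cdot> f"
      and g: "t' = (\<rho>', g, \<rho>'')" "g \<in> J" "g \<in> Hom K (Dom K \<rho>') (Dom K \<rho>'')" "g \<cdot> \<rho>' \<preceq> \<rho>'' \<cdot> g"
      using t t' by (auto simp: Hom_lax_endo_cat)
    have "(g \<cdot> f) \<cdot> \<rho> \<preceq> \<rho>'' \<cdot> (g \<cdot> f)"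
      by (rule lax_square_Comp [OF \<rho> [THEN lax_endoD(1)] f(3) f(3) g(3) g(3) f(4) g(4)])
    then show ?thesis
      using f g \<rho> Comp_in_J [OF f(2) g(2) f(3) g(3)] Comp_in_Hom [OF f(3) g(3)]
      by (simp add: Hom_lax_endo_cat lax_endo_cat_simps)
  qed
  show "(t3 \<cdot>\<^bsub>?L\<^esub> t2) \<cdot>\<^bsub>?L\<^esub> t1 = t3 \<cdot>\<^bsub>?L\<^esub> (t2 \<cdot>\<^bsub>?L\<^esub> t1)"
    if "t1 \<in> Hom ?L \<rho>0 \<rho>1" "t2 \<in> Hom ?L \<rho>1 \<rho>2" "t3 \<in> Hom ?L \<rho>2 \<rho>3" for t1 t2 t3 \<rho>0 \<rho>1 \<rho>2 \<rho>3
    using that Comp_assoc by (auto simp: Hom_lax_endo_cat lax_endo_cat_simps)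
  show "t \<cdot>\<^bsub>?L\<^esub> Idt ?L \<rho> = t" "Idt ?L \<rho>' \<cdot>\<^bsub>?L\<^esub> t = t" if "t \<in> Hom ?L \<rho> \<rho>'" for t \<rho> \<rho>'
    using that Comp_Idt_left Comp_Idt_right by (auto simp: Hom_lax_endo_cat lax_endo_cat_simps)
  show "partial_order (Hom_poset ?L \<rho> \<rho>')" for \<rho> \<rho>'
  proof (rule partial_order_Hom_posetI)
    show "t \<preceq>\<^bsub>?L\<^esub> t" if "t \<in> Hom ?L \<rho> \<rho>'" for t
      using that Le_refl by (auto simp: Hom_lax_endo_cat lax_endo_cat_simps)
    show "t = t'" if "t \<in> Hom ?L \<rho> \<rho>'" "t' \<in> Hom ?L \<rho> \<rho>'" "t \<preceq>\<^bsub>?L\<^esub> t'" "t' \<preceq>\<^bsub>?L\<^esub> t" for t t'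
      using that by (auto simp: Hom_lax_endo_cat lax_endo_cat_simps elim: Le_antisym)
    show "t \<preceq>\<^bsub>?L\<^esub> t''" if "t \<in> Hom ?L \<rho> \<rho>'" "t' \<in> Hom ?L \<rho> \<rho>'" "t'' \<in> Hom ?L \<rho> \<rho>'"
      "t \<preceq>\<^bsub>?L\<^esub> t'" "t' \<preceq>\<^bsub>?L\<^esub> t''" for t t' t''
      using that by (auto simp: Hom_lax_endo_cat lax_endo_cat_simps elim: Le_trans)
  qed
  show "g \<cdot>\<^bsub>?L\<^esub> f \<preceq>\<^bsub>?L\<^esub> g' \<cdot>\<^bsub>?L\<^esub> f'"
    if "f \<in> Hom ?L \<rho> \<rho>'" "f' \<in> Hom ?L \<rho> \<rho>'" "g \<in> Hom ?L \<rho>' \<rho>''" "g' \<in> Hom ?L \<rho>' \<rho>''"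
      "f \<preceq>\<^bsub>?L\<^esub> f'" "g \<preceq>\<^bsub>?L\<^esub> g'" for f f' g g' \<rho> \<rho>' \<rho>''
    using that Comp_mono by (auto simp: Hom_lax_endo_cat lax_endo_cat_simps)
qed

section \<open>The change-of-base functor\<close>

lemma change_of_base_simps:
  "omap (omap (change_of_base D K) \<rho>) = (\<lambda>X\<in>Obj D. Dom K \<rho>)"
  "amap (omap (change_of_base D K) \<rho>) = (\<lambda>d\<in>Arr D. \<rho>)"
  "amap (change_of_base D K) (\<rho>, f, \<rho>') =
    (omap (change_of_base D K) \<rho>, \<lambda>X\<in>Obj D. f, omap (change_of_base D K) \<rho>')"
  by (simp_all add: change_of_base_def Let_def)

text \<open>For constant data the two laxity conditions become the two inequalities required of a
  lax endomorphism.\<close>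

lemma lax_functor_change_of_base:
  assumes "lax_endo K \<rho>"
  shows "lax_functor D K (omap (change_of_base D K) \<rho>)"
  using lax_endoD [OF assms] Hom_ObjD(1) [OF lax_endoD(1) [OF assms]]
    D.Dom_closed D.Cod_closed D.Idt_in_Hom D.Comp_in_Hom
  by (auto simp: lax_functor_def change_of_base_simps Hom_def)

lemma order_functor_change_of_base:
  "order_functor (lax_endo_cat K J) (lax_cat D K J) (change_of_base D K)"
proof (intro order_functor.intro order_functor_axioms.intro order_category_lax_cat order_category_lax_endo_cat)
  let ?E = "lax_endo_cat K J" and ?L = "lax_cat D K J" and ?G = "change_of_base D K"
  show "omap ?G \<rho> \<in> Obj ?L" if "\<rho> \<in> Obj ?E" for \<rho>
    using that by (simp add: lax_cat_simps lax_endo_cat_simps lax_functor_change_of_base)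
  show "amap ?G t \<in> Hom ?L (omap ?G \<rho>) (omap ?G \<rho>')" if "t \<in> Hom ?E \<rho> \<rho>'" for t \<rho> \<rho>'
    using that D.Dom_closed D.Cod_closed
    by (auto simp: Hom_lax_cat Hom_lax_endo_cat change_of_base_simps lax_functor_change_of_base
        oplax_transformation_def)
  show "amap ?G (Idt ?E \<rho>) = Idt ?L (omap ?G \<rho>)" for \<rho>
    by (auto simp: lax_cat_simps lax_endo_cat_simps change_of_base_simps intro!: restrict_ext)
  show "amap ?G (t' \<cdot>\<^bsub>?E\<^esub> t) = amap ?G t' \<cdot>\<^bsub>?L\<^esub> amap ?G t"
    if "t \<in> Hom ?E \<rho> \<rho>'" "t' \<in> Hom ?E \<rho>' \<rho>''" for t t' \<rho> \<rho>' \<rho>''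
    using that by (auto simp: Hom_lax_endo_cat lax_cat_simps lax_endo_cat_simps
        change_of_base_simps intro!: restrict_ext)
  show "amap ?G t \<preceq>\<^bsub>?L\<^esub> amap ?G t'"
    if "t \<in> Hom ?E \<rho> \<rho>'" "t' \<in> Hom ?E \<rho> \<rho>'" "t \<preceq>\<^bsub>?E\<^esub> t'" for t t' \<rho> \<rho>'
    using that by (auto simp: Hom_lax_endo_cat lax_cat_simps lax_endo_cat_simps change_of_base_simps)
qed

end


section \<open>The adjunction\<close>

context sigma_bang_setting
begin

section \<open>Morphisms out of \<open>Sigma_bang_obj\<close>\<close>

lemma Dom_Sigma: "lax_functor D K \<pi> \<Longrightarrow> Dom K (Sigma_bang_obj D K S \<iota> \<pi>) = S (omap \<pi>)"
  using Sigma_bang_obj_Hom by (auto simp: Hom_def)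

text \<open>The restrictions of \<open>g\<close> lie in \<open>J\<close> and are well typed because
  the injections are, so only the inequalities of \<open>Comp_Sigma_le_iff\<close> remain.\<close>

lemma Hom_Sigma_iff:
  assumes \<pi>: "lax_functor D K \<pi>" and \<rho>: "lax_endo K \<rho>"
    and g: "g \<in> J" "g \<in> Hom K (S (omap \<pi>)) (Dom K \<rho>)"
  shows "g \<cdot> Sigma_bang_obj D K S \<iota> \<pi> \<preceq> \<rho> \<cdot> g \<longleftrightarrow>
    oplax_transformation D K J \<pi> (omap (change_of_base D K) \<rho>) (\<lambda>A\<in>Obj D. g \<cdot> \<iota> (omap \<pi>) A)"
proof -
  have "g \<cdot> \<iota> (omap \<pi>) A \<in> J" "g \<cdot> \<iota> (omap \<pi>) A \<in> Hom K (omap \<pi> A) (Dom K \<rho>)" if "A \<in> Obj D" for A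
    using g inj_Hom [OF \<pi> that] inj_in_J [OF \<pi> that] by (simp_all add: Comp_in_J Comp_in_Hom)
  then show ?thesis
    by (simp add: Comp_Sigma_le_iff [OF \<pi> g(2) \<rho>] oplax_transformation_def change_of_base_simps
        D.Dom_closed D.Cod_closed)
qed

section \<open>The action of \<open>Sigma_bang\<close> on transformations\<close>

definition Sum_map ::
  "('d, 'e, 'o, 'a) mapping \<Rightarrow> ('d \<Rightarrow> 'a) \<Rightarrow> ('d, 'e, 'o, 'a) mapping \<Rightarrow> 'a" where
  "Sum_map \<pi> f \<pi>' = cotuple K (Obj D) (S (omap \<pi>)) (\<iota> (omap \<pi>)) (S (omap \<pi>')) (\<lambda>A. \<iota> (omap \<pi>') A \<cdot> f A)"

lemma Sigma_bang_simps:
  "omap (Sigma_bang D K S \<iota>) \<pi> = Sigma_bang_obj D K S \<iota> \<pi>"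
  "amap (Sigma_bang D K S \<iota>) (\<pi>, f, \<pi>') =
    (Sigma_bang_obj D K S \<iota> \<pi>, Sum_map \<pi> f \<pi>', Sigma_bang_obj D K S \<iota> \<pi>')"
  by (simp_all add: Sigma_bang_def Sum_map_def)

lemma Sum_map:
  assumes \<pi>: "lax_functor D K \<pi>" "lax_functor D K \<pi>'"
    and f: "oplax_transformation D K J \<pi> \<pi>' f"
  shows Sum_map_Hom: "Sum_map \<pi> f \<pi>' \<in> Hom K (S (omap \<pi>)) (S (omap \<pi>'))"
    and Sum_map_in_J: "Sum_map \<pi> f \<pi>' \<in> J"
    and Sum_map_inj: "A \<in> Obj D \<Longrightarrow> Sum_map \<pi> f \<pi>' \<cdot> \<iota> (omap \<pi>) A = \<iota> (omap \<pi>') A \<cdot> f A"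
    and Sum_map_square: "Sum_map \<pi> f \<pi>' \<cdot> Sigma_bang_obj D K S \<iota> \<pi> \<preceq>
      Sigma_bang_obj D K S \<iota> \<pi>' \<cdot> Sum_map \<pi> f \<pi>'"
proof -
  have H: "\<iota> (omap \<pi>') A \<cdot> f A \<in> Hom K (omap \<pi> A) (S (omap \<pi>'))"
    and Hj: "\<iota> (omap \<pi>') A \<cdot> f A \<in> J" if "A \<in> Obj D" for A
    using inj_Hom [OF \<pi>(2) that] inj_in_J [OF \<pi>(2) that] oplax_transformationD(2,3) [OF f that]
    by (simp_all add: Comp_in_Hom Comp_in_J)
  note S' = S_Obj [OF \<pi>(2)] and c = coproduct [OF \<pi>(1)]
  show F: "Sum_map \<pi> f \<pi>' \<in> Hom K (S (omap \<pi>)) (S (omap \<pi>'))"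
    unfolding Sum_map_def by (rule cotuple_Hom [OF c S' H])
  show Fj: "Sum_map \<pi> f \<pi>' \<in> J"
    unfolding Sum_map_def by (rule cotuple_in_J [OF \<pi>(1) S' Hj H])
  show Fi: "Sum_map \<pi> f \<pi>' \<cdot> \<iota> (omap \<pi>) A = \<iota> (omap \<pi>') A \<cdot> f A" if "A \<in> Obj D" for A
    unfolding Sum_map_def by (rule cotuple_inj [OF c S' H that])
  let ?s' = "Sigma_bang_obj D K S \<iota> \<pi>'"
  note \<rho> = lax_endo_Sigma [OF \<pi>(2)]
  have I: "Idt K (S (omap \<pi>')) \<in> Hom K (S (omap \<pi>')) (S (omap \<pi>'))"
    using Idt_in_Hom [OF S'] .
  have s': "?s' \<in> Hom K (S (omap \<pi>')) (S (omap \<pi>'))"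
    by (rule Sigma_bang_obj_Hom [OF \<pi>(2)])
  \<comment> \<open>The injections are the unit \<open>\<pi>' \<rightarrow> [!, K] (\<Sigma>\<^sub>! \<pi>')\<close>; composing it with \<open>f\<close> and transposing
    back gives the square for \<open>\<Sigma>\<^sub>! f\<close>.\<close>
  have "oplax_transformation D K J \<pi>' (omap (change_of_base D K) ?s')
      (\<lambda>A\<in>Obj D. Idt K (S (omap \<pi>')) \<cdot> \<iota> (omap \<pi>') A)"
    using Hom_Sigma_iff [OF \<pi>(2) \<rho>, of "Idt K (S (omap \<pi>'))"] I sub_Idt [OF S'] Le_refl [OF s']
    by (simp add: Dom_Sigma [OF \<pi>(2)] Comp_Idt_left [OF s'] Comp_Idt_right [OF s'])
  then have "oplax_transformation D K J \<pi> (omap (change_of_base D K) ?s')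
      (\<lambda>A\<in>Obj D. (\<lambda>A\<in>Obj D. Idt K (S (omap \<pi>')) \<cdot> \<iota> (omap \<pi>') A) A \<cdot> f A)"
    using oplax_transformation_Comp [OF \<pi> lax_functor_change_of_base [OF \<rho>] f] by blast
  moreover have "(\<lambda>A\<in>Obj D. (\<lambda>A\<in>Obj D. Idt K (S (omap \<pi>')) \<cdot> \<iota> (omap \<pi>') A) A \<cdot> f A) =
      (\<lambda>A\<in>Obj D. Sum_map \<pi> f \<pi>' \<cdot> \<iota> (omap \<pi>) A)"
    using Fi Comp_Idt_left [OF inj_Hom [OF \<pi>(2)]] by (auto intro!: restrict_ext)
  ultimately show "Sum_map \<pi> f \<pi>' \<cdot> Sigma_bang_obj D K S \<iota> \<pi> \<preceq> ?s' \<cdot> Sum_map \<pi> f \<pi>'"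
    using Hom_Sigma_iff [OF \<pi>(1) \<rho> Fj] F by (simp only: Dom_Sigma [OF \<pi>(2)])
qed

text \<open>Preservation of identities and composites follows from the uniqueness of cotuples, and
  monotonicity from the joint order reflection of the injections.\<close>

lemma order_functor_Sigma_bang:
  "order_functor (lax_cat D K J) (lax_endo_cat K J) (Sigma_bang D K S \<iota>)"
proof (intro order_functor.intro order_functor_axioms.intro order_category_lax_cat order_category_lax_endo_cat)
  let ?E = "lax_endo_cat K J" and ?L = "lax_cat D K J" and ?F = "Sigma_bang D K S \<iota>"
  show "omap ?F \<pi> \<in> Obj ?E" if "\<pi> \<in> Obj ?L" for \<pi>
    using that lax_endo_Sigma by (simp add: lax_cat_simps lax_endo_cat_simps Sigma_bang_simps)
  show "amap ?F t \<in> Hom ?E (omap ?F \<pi>) (omap ?F \<pi>')" if "t \<in> Hom ?L \<pi> \<pi>'" for t \<pi> \<pi>'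
    using that lax_endo_Sigma Sum_map
    by (auto simp: Hom_lax_cat Hom_lax_endo_cat Sigma_bang_simps Dom_Sigma)
  show "amap ?F (Idt ?L \<pi>) = Idt ?E (omap ?F \<pi>)" if "\<pi> \<in> Obj ?L" for \<pi>
  proof -
    have \<pi>: "lax_functor D K \<pi>"
      using that by (simp add: lax_cat_simps)
    have "Sum_map \<pi> (\<lambda>X\<in>Obj D. Idt K (omap \<pi> X)) \<pi> = Idt K (S (omap \<pi>))"
      unfolding Sum_map_def
      by (rule cotuple_eqI [OF coproduct [OF \<pi>] Idt_in_Hom [OF S_Obj [OF \<pi>]]])
        (simp add: Comp_Idt_left [OF inj_Hom [OF \<pi>]] Comp_Idt_right [OF inj_Hom [OF \<pi>]])
    then show ?thesis
      by (simp add: lax_cat_simps lax_endo_cat_simps Sigma_bang_simps Dom_Sigma [OF \<pi>])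
  qed
  show "amap ?F (t' \<cdot>\<^bsub>?L\<^esub> t) = amap ?F t' \<cdot>\<^bsub>?E\<^esub> amap ?F t"
    if t: "t \<in> Hom ?L \<pi> \<pi>'" and t': "t' \<in> Hom ?L \<pi>' \<pi>''" for t t' \<pi> \<pi>' \<pi>''
  proof -
    obtain f g where
      \<pi>: "lax_functor D K \<pi>" "lax_functor D K \<pi>'" "lax_functor D K \<pi>''"
      and f: "t = (\<pi>, f, \<pi>')" "oplax_transformation D K J \<pi> \<pi>' f"
      and g: "t' = (\<pi>', g, \<pi>'')" "oplax_transformation D K J \<pi>' \<pi>'' g"
      using t t' by (auto simp: Hom_lax_cat)
    note F = Sum_map [OF \<pi>(1,2) f(2)] and G = Sum_map [OF \<pi>(2,3) g(2)]
    have "Sum_map \<pi> (\<lambda>X\<in>Obj D. g X \<cdot> f X) \<pi>'' = Sum_map \<pi>' g \<pi>'' \<cdot> Sum_map \<pi> f \<pi>'"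
      \<comment> \<open>Only the sum of the composite transformation is unfolded. It is the cotuple
        to be identified; the two factors enter through their equations on the injections.\<close>
      unfolding Sum_map_def [of \<pi> _ \<pi>'']
    proof (rule cotuple_eqI [OF coproduct [OF \<pi>(1)] Comp_in_Hom [OF F(1) G(1)]])
      fix A assume A: "A \<in> Obj D"
      note i = inj_Hom [OF \<pi>(1) A] inj_Hom [OF \<pi>(2) A] inj_Hom [OF \<pi>(3) A]
        and fA = oplax_transformationD(3) [OF f(2) A] and gA = oplax_transformationD(3) [OF g(2) A]
      show "(Sum_map \<pi>' g \<pi>'' \<cdot> Sum_map \<pi> f \<pi>') \<cdot> \<iota> (omap \<pi>) A =
          \<iota> (omap \<pi>'') A \<cdot> (\<lambda>X\<in>Obj D. g X \<cdot> f X) A"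
        using A F(3) [OF A] G(3) [OF A] Comp_assoc [OF i(1) F(1) G(1)] Comp_assoc [OF fA i(2) G(1)]
          Comp_assoc [OF fA gA i(3)] by simp
    qed
    then show ?thesis
      by (simp add: f g lax_cat_simps lax_endo_cat_simps Sigma_bang_simps)
  qed
  show "amap ?F t \<preceq>\<^bsub>?E\<^esub> amap ?F t'"
    if t: "t \<in> Hom ?L \<pi> \<pi>'" "t' \<in> Hom ?L \<pi> \<pi>'" "t \<preceq>\<^bsub>?L\<^esub> t'" for t t' \<pi> \<pi>'
  proof -
    obtain f g where
      \<pi>: "lax_functor D K \<pi>" "lax_functor D K \<pi>'"
      and f: "t = (\<pi>, f, \<pi>')" "oplax_transformation D K J \<pi> \<pi>' f"
      and g: "t' = (\<pi>, g, \<pi>')" "oplax_transformation D K J \<pi> \<pi>' g"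
      using t by (auto simp: Hom_lax_cat)
    have "\<iota> (omap \<pi>') A \<cdot> f A \<preceq> \<iota> (omap \<pi>') A \<cdot> g A" if A: "A \<in> Obj D" for A
      using t(3) A Comp_mono_right [OF oplax_transformationD(3) [OF f(2) A]
          oplax_transformationD(3) [OF g(2) A] inj_Hom [OF \<pi>(2) A]]
      by (simp add: f g lax_cat_simps)
    then have "Sum_map \<pi> f \<pi>' \<preceq> Sum_map \<pi> g \<pi>'"
      by (intro coproduct_Hom_leI [OF coproduct [OF \<pi>(1)] Sum_map_Hom [OF \<pi> f(2)] Sum_map_Hom [OF \<pi> g(2)]])
        (simp add: Sum_map_inj [OF \<pi> f(2)] Sum_map_inj [OF \<pi> g(2)])
    then show ?thesis
      by (simp add: f g lax_endo_cat_simps Sigma_bang_simps)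
  qed
qed

section \<open>The isomorphism of hom-posets and its naturality\<close>

definition transpose where
  "transpose \<pi> \<rho> t = (\<pi>, \<lambda>A\<in>Obj D. fst (snd t) \<cdot> \<iota> (omap \<pi>) A, omap (change_of_base D K) \<rho>)"

text \<open>Injectivity is the uniqueness of arrows out of a coproduct, and surjectivity is the
  existence of cotuples. The order is preserved because composition is monotone and reflected
  because the injections jointly reflect it.\<close>

lemma poset_iso_transpose:
  assumes \<pi>: "lax_functor D K \<pi>" and \<rho>: "lax_endo K \<rho>"
  shows "poset_iso (Hom_poset (lax_endo_cat K J) (Sigma_bang_obj D K S \<iota> \<pi>) \<rho>)
    (Hom_poset (lax_cat D K J) \<pi> (omap (change_of_base D K) \<rho>)) (transpose \<pi> \<rho>)"
proof -
  let ?E = "lax_endo_cat K J" and ?L = "lax_cat D K J" and ?G = "omap (change_of_base D K) \<rho>"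
    and ?s = "Sigma_bang_obj D K S \<iota> \<pi>"
  \<comment> \<open>Through \<open>Hom_Sigma_iff\<close> the source hom-set is described by the very
    oplaxity condition that defines the target hom-set.\<close>
  have in_Hom: "t \<in> Hom ?E ?s \<rho> \<longleftrightarrow> (\<exists>f. t = (?s, f, \<rho>) \<and> f \<in> J \<and> f \<in> Hom K (S (omap \<pi>)) (Dom K \<rho>) \<and>
      oplax_transformation D K J \<pi> ?G (\<lambda>A\<in>Obj D. f \<cdot> \<iota> (omap \<pi>) A))" for t
    using Hom_Sigma_iff [OF \<pi> \<rho>] by (auto simp: Hom_lax_endo_cat Dom_Sigma \<pi> \<rho> lax_endo_Sigma)
  note G = lax_functor_change_of_base [OF \<rho>]
  have "bij_betw (transpose \<pi> \<rho>) (Hom ?E ?s \<rho>) (Hom ?L \<pi> ?G)"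
    unfolding bij_betw_def
  proof (intro conjI inj_onI equalityI subsetI)
    fix t t' assume "t \<in> Hom ?E ?s \<rho>" "t' \<in> Hom ?E ?s \<rho>" and eq: "transpose \<pi> \<rho> t = transpose \<pi> \<rho> t'"
    then obtain f f' where f: "t = (?s, f, \<rho>)" "f \<in> Hom K (S (omap \<pi>)) (Dom K \<rho>)"
        "t' = (?s, f', \<rho>)" "f' \<in> Hom K (S (omap \<pi>)) (Dom K \<rho>)"
      using in_Hom by blast
    have "f \<cdot> \<iota> (omap \<pi>) A = f' \<cdot> \<iota> (omap \<pi>) A" if "A \<in> Obj D" for A
      using eq that by (auto simp: transpose_def f dest: fun_cong [of _ _ A])
    then show "t = t'"
      using coproduct_Hom_eqI [OF \<pi> f(2,4)] f by simp
  next
    fix u assume "u \<in> transpose \<pi> \<rho> ` Hom ?E ?s \<rho>"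
    then show "u \<in> Hom ?L \<pi> ?G"
      using in_Hom \<pi> G by (auto simp: Hom_lax_cat transpose_def)
  next
    fix u assume "u \<in> Hom ?L \<pi> ?G"
    then obtain f where u: "u = (\<pi>, f, ?G)" and f: "oplax_transformation D K J \<pi> ?G f"
      by (auto simp: Hom_lax_cat)
    \<comment> \<open>The preimage of \<open>f\<close> has to restrict to \<open>f A\<close> on each
      summand, which forces the cotuple; it lies in \<open>J\<close> because the components
      do.\<close>
    let ?h = "cotuple K (Obj D) (S (omap \<pi>)) (\<iota> (omap \<pi>)) (Dom K \<rho>) f"
    have Y: "Dom K \<rho> \<in> Obj K"
      using Hom_ObjD lax_endoD(1) [OF \<rho>] by blast
    have fH: "f A \<in> Hom K (omap \<pi> A) (Dom K \<rho>)" if "A \<in> Obj D" for A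
      using oplax_transformationD(3) [OF f that] that by (simp add: change_of_base_simps)
    \<comment> \<open>Since \<open>f\<close> is extensional, agreement on \<open>Obj D\<close> is
      equality of functions, so that the transposed triple is \<open>u\<close> itself.\<close>
    have hi: "(\<lambda>A\<in>Obj D. ?h \<cdot> \<iota> (omap \<pi>) A) = f"
      using cotuple_inj [OF coproduct [OF \<pi>] Y fH] oplax_transformationD(1) [OF f]
      by (auto intro!: extensionalityI [of _ "Obj D"])
    have "(?s, ?h, \<rho>) \<in> Hom ?E ?s \<rho>"
      using in_Hom hi f cotuple_Hom [OF coproduct [OF \<pi>] Y fH]
        cotuple_in_J [OF \<pi> Y oplax_transformationD(2) [OF f] fH] by simp
    moreover have "transpose \<pi> \<rho> (?s, ?h, \<rho>) = u"
      using hi u by (simp add: transpose_def)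
    ultimately show "u \<in> transpose \<pi> \<rho> ` Hom ?E ?s \<rho>"
      by (metis imageI)
  qed
  moreover have "t \<preceq>\<^bsub>?E\<^esub> t' \<longleftrightarrow> transpose \<pi> \<rho> t \<preceq>\<^bsub>?L\<^esub> transpose \<pi> \<rho> t'"
    if "t \<in> Hom ?E ?s \<rho>" "t' \<in> Hom ?E ?s \<rho>" for t t'
  proof -
    obtain f f' where f: "t = (?s, f, \<rho>)" "f \<in> Hom K (S (omap \<pi>)) (Dom K \<rho>)"
        "t' = (?s, f', \<rho>)" "f' \<in> Hom K (S (omap \<pi>)) (Dom K \<rho>)"
      using \<open>t \<in> _\<close> \<open>t' \<in> _\<close> in_Hom by blast
    have "f \<preceq> f' \<longleftrightarrow> (\<forall>A\<in>Obj D. f \<cdot> \<iota> (omap \<pi>) A \<preceq> f' \<cdot> \<iota> (omap \<pi>) A)"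
      using coproduct_Hom_leI [OF coproduct [OF \<pi>] f(2,4)] Comp_mono_left [OF inj_Hom [OF \<pi>] f(2,4)]
      by blast
    then show ?thesis
      by (simp add: f transpose_def lax_cat_simps lax_endo_cat_simps)
  qed
  ultimately show ?thesis
    by (simp add: poset_iso_def Hom_poset_def)
qed

text \<open>With the functors and the hom-poset isomorphism at hand, naturality remains. In
  \<open>\<pi>\<close> it combines the equations of \<open>Sum_map\<close> on the injections with
  associativity; in \<open>\<rho>\<close> it is associativity applied to each component.\<close>

theorem left_2adjoint_Sigma_bang:
  "left_2adjoint (lax_cat D K J) (lax_endo_cat K J) (Sigma_bang D K S \<iota>) (change_of_base D K)"
  unfolding left_2adjoint_def
proof (intro conjI order_functor_Sigma_bang order_functor_change_of_base exI [of _ transpose] ballI)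
  let ?E = "lax_endo_cat K J" and ?L = "lax_cat D K J" and ?F = "Sigma_bang D K S \<iota>"
    and ?G = "change_of_base D K"
  fix \<pi> \<rho> assume \<pi>: "\<pi> \<in> Obj ?L" and \<rho>: "\<rho> \<in> Obj ?E"
  then show "poset_iso (Hom_poset ?E (omap ?F \<pi>) \<rho>) (Hom_poset ?L \<pi> (omap ?G \<rho>)) (transpose \<pi> \<rho>)"
    using poset_iso_transpose by (simp add: lax_cat_simps lax_endo_cat_simps Sigma_bang_simps)
next
  let ?E = "lax_endo_cat K J" and ?L = "lax_cat D K J" and ?F = "Sigma_bang D K S \<iota>"
    and ?G = "change_of_base D K"
  fix \<pi> \<pi>' \<rho> t u assume "t \<in> Hom ?L \<pi>' \<pi>" "u \<in> Hom ?E (omap ?F \<pi>) \<rho>"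
  then obtain f g where \<pi>: "lax_functor D K \<pi>'" "lax_functor D K \<pi>"
    and t: "t = (\<pi>', f, \<pi>)" and f: "oplax_transformation D K J \<pi>' \<pi> f"
    and u: "u = (Sigma_bang_obj D K S \<iota> \<pi>, g, \<rho>)" and g: "g \<in> Hom K (S (omap \<pi>)) (Dom K \<rho>)"
    by (auto simp: Hom_lax_cat Hom_lax_endo_cat Sigma_bang_simps Dom_Sigma)
  have "(g \<cdot> Sum_map \<pi>' f \<pi>) \<cdot> \<iota> (omap \<pi>') A = (g \<cdot> \<iota> (omap \<pi>) A) \<cdot> f A" if A: "A \<in> Obj D" for A
    using Comp_assoc [OF inj_Hom [OF \<pi>(1) A] Sum_map_Hom [OF \<pi> f] g] Sum_map_inj [OF \<pi> f A]
      Comp_assoc [OF oplax_transformationD(3) [OF f A] inj_Hom [OF \<pi>(2) A] g] by simp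
  then show "transpose \<pi>' \<rho> (u \<cdot>\<^bsub>?E\<^esub> amap ?F t) = transpose \<pi> \<rho> u \<cdot>\<^bsub>?L\<^esub> t"
    by (auto simp: t u transpose_def Sigma_bang_simps lax_cat_simps lax_endo_cat_simps intro!: restrict_ext)
next
  let ?E = "lax_endo_cat K J" and ?L = "lax_cat D K J" and ?F = "Sigma_bang D K S \<iota>"
    and ?G = "change_of_base D K"
  fix \<pi> \<rho> \<rho>' t u assume "\<pi> \<in> Obj ?L" "t \<in> Hom ?E \<rho> \<rho>'" "u \<in> Hom ?E (omap ?F \<pi>) \<rho>"
  then obtain f g where \<pi>: "lax_functor D K \<pi>"
    and t: "t = (\<rho>, f, \<rho>')" and f: "f \<in> Hom K (Dom K \<rho>) (Dom K \<rho>')"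
    and u: "u = (Sigma_bang_obj D K S \<iota> \<pi>, g, \<rho>)" and g: "g \<in> Hom K (S (omap \<pi>)) (Dom K \<rho>)"
    by (auto simp: Hom_lax_endo_cat lax_cat_simps Sigma_bang_simps Dom_Sigma)
  show "transpose \<pi> \<rho>' (t \<cdot>\<^bsub>?E\<^esub> u) = amap ?G t \<cdot>\<^bsub>?L\<^esub> transpose \<pi> \<rho> u"
    using Comp_assoc [OF inj_Hom [OF \<pi>] g f]
    by (auto simp: t u transpose_def change_of_base_simps lax_cat_simps lax_endo_cat_simps intro!: restrict_ext)
qed

end

theorem theorem3p16:
  fixes D :: "('d, 'e) cat" and K :: "('o, 'a) ocat" and J :: "'a set"
    and S :: "('d \<Rightarrow> 'o) \<Rightarrow> 'o" and \<iota> :: "('d \<Rightarrow> 'o) \<Rightarrow> 'd \<Rightarrow> 'a"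
  assumes "category D"
    and "order_category K"
    and "wide_subcategory K J"
    and "has_coproducts (subcat K J) (Obj D)"
    and "has_coproducts K (Obj D)"
    and "inclusion_preserves_coproducts K J (Obj D)"
    and "left_distributive_dcpo_join_category K"
    and "cotupling_preserves_order K (Obj D)"
    and "coproduct_choice (subcat K J) (Obj D) S \<iota>"
  shows "left_2adjoint (lax_cat D K J) (lax_endo_cat K J) (Sigma_bang D K S \<iota>) (change_of_base D K)"
proof -
  interpret sigma_bang_setting D K J S \<iota>
    using assms
    by (intro sigma_bang_setting.intro oplax_setting.intro sigma_bang_setting_axioms.intro)
  show ?thesis
    by (rule left_2adjoint_Sigma_bang)
qed

end
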